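(* There is a randomized algorithm in the static multiple-access channel model (with collision detection) that, on an input graph with $m$ edges and positive edge weights, finds a minimum-weight spanning forest $T$ in expected time $\mathcal{O}(|T|+W\log m)$, where $W$ is the number of distinct weights on the edges of $T$, and in worst-case time $\mathcal{O}(m)$.
   Context: Model: the input is a simple graph $G$ on vertex set $\{1,\dots,n\}$ with $m$ edges, each edge having a positive weight. There are $m$ stations with distinct IDs $1,\dots,m$; each station holds exactly one edge together with its weight, and every edge is held by exactly one station. All stations know $n$; they do not know $m$. Computation is synchronous with a global clock. In each step every station broadcasts a message or not; if exactly one station broadcasts its message is heard by all; if none, silence is heard; if two or more, a collision signal distinct from silence is heard by all. All stations participate from the first step. An edge is revealed when it is heard on the channel. A spanning forest is a maximal acyclic subgraph of $G$; a minimum-weight spanning forest is one of minimum total weight. The algorithm finds $T$ if all edges of $T$ are revealed before termination; $|T|$ is the number of edges of $T$; time is the number of steps until termination. Randomized algorithms may use independent random coin flips at the stations. *)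

theory Defs
  imports "HOL-Probability.Probability" "HOL-Probability.Product_PMF"
begin

type_synonym edge = "nat set"

(* The station with identifier i (1 \<le> i \<le> m) holds the edge "held i" and its weight. *)
record input =
  num_vertices :: nat
  edges :: "edge set"
  weight :: "edge \<Rightarrow> real"
  held :: "nat \<Rightarrow> edge"

definition num_edges :: "input \<Rightarrow> nat" where
  "num_edges I = card (edges I)"

definition stations :: "input \<Rightarrow> nat set" where
  "stations I = {1..num_edges I}"

definition valid_input :: "input \<Rightarrow> bool" where
  "valid_input I \<longleftrightarrow>
     (\<forall>e\<in>edges I. e \<subseteq> {1..num_vertices I} \<and> card e = 2) \<and>
     (\<forall>e\<in>edges I. weight I e > 0) \<and>
     bij_betw (held I) (stations I) (edges I)"

(* A cycle is given by its distinct vertices in cyclic order. *)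
definition acyclic_edges :: "edge set \<Rightarrow> bool" where
  "acyclic_edges F \<longleftrightarrow>
     \<not> (\<exists>vs. length vs \<ge> 3 \<and> distinct vs \<and>
          (\<forall>i<length vs. {vs ! i, vs ! (Suc i mod length vs)} \<in> F))"

definition spanning_forest :: "edge set \<Rightarrow> edge set \<Rightarrow> bool" where
  "spanning_forest E F \<longleftrightarrow>
     F \<subseteq> E \<and> acyclic_edges F \<and>
     (\<forall>F'. F \<subseteq> F' \<and> F' \<subseteq> E \<and> acyclic_edges F' \<longrightarrow> F' = F)"

definition min_spanning_forest :: "input \<Rightarrow> edge set \<Rightarrow> bool" where
  "min_spanning_forest I T \<longleftrightarrow>
     spanning_forest (edges I) T \<and>
     (\<forall>F. spanning_forest (edges I) F \<longrightarrow> sum (weight I) T \<le> sum (weight I) F)"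

(* A message may carry the sender's own edge, together with arbitrary further data
   (for instance the weight of that edge). *)
datatype message = Message (message_edge: "edge option") (message_data: "real list")

datatype feedback = Silence | Heard message | Collision

(* In "Broadcast b xs" the flag b says whether the sender's edge is put into the message.
   The edge itself is filled in by the channel, so a station cannot announce an edge that
   it does not hold. *)
datatype action = Listen | is_Broadcast: Broadcast bool "real list"

(* Everything a station knows; in particular the number m of edges is not part of it.
   "my_flips" has one entry per past step, namely the list of the coins flipped in that step. *)
record view =
  known_vertices :: nat
  my_id :: nat
  my_edge :: edge
  my_weight :: real
  my_flips :: "bool list list"
  channel_heard :: "feedback list"

(* Before each step a station flips "coin_count" fair coins and chooses its action from its
   view and the outcomes of these new flips. "halts" is evaluated on the view before the first
   step and after every step. *)
record algorithm =
  coin_count :: "view \<Rightarrow> nat"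
  choose_action :: "view \<Rightarrow> bool list \<Rightarrow> action"
  halts :: "view \<Rightarrow> bool"

record config =
  flips :: "nat \<Rightarrow> bool list list"
  channel :: "feedback list"
  halted :: "nat set"

definition view_of :: "input \<Rightarrow> (nat \<Rightarrow> bool list list) \<Rightarrow> feedback list \<Rightarrow> nat \<Rightarrow> view" where
  "view_of I f h i =
     \<lparr>known_vertices = num_vertices I, my_id = i, my_edge = held I i,
      my_weight = weight I (held I i), my_flips = f i, channel_heard = h\<rparr>"

definition fair_coins :: "nat \<Rightarrow> bool list pmf" where
  "fair_coins k = pmf_of_set {bs. length bs = k}"

fun message_of :: "input \<Rightarrow> nat \<Rightarrow> action \<Rightarrow> message" where
  "message_of I i (Broadcast b xs) = Message (if b then Some (held I i) else None) xs"
| "message_of I i Listen = Message None []"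

(* Only applied to the stations in S; the second equation of "message_of" is never used here. *)
definition channel_feedback :: "input \<Rightarrow> nat set \<Rightarrow> (nat \<Rightarrow> action) \<Rightarrow> feedback" where
  "channel_feedback I S a =
     (let B = {i\<in>S. is_Broadcast (a i)} in
      if B = {} then Silence
      else if card B = 1 then Heard (message_of I (the_elem B) (a (the_elem B)))
      else Collision)"

definition active :: "input \<Rightarrow> config \<Rightarrow> nat set" where
  "active I c = stations I - halted c"

definition terminated :: "input \<Rightarrow> config \<Rightarrow> bool" where
  "terminated I c \<longleftrightarrow> stations I \<subseteq> halted c"

definition initial :: "algorithm \<Rightarrow> input \<Rightarrow> config" where
  "initial A I =
     \<lparr>flips = (\<lambda>_. []), channel = [],
      halted = {i\<in>stations I. halts A (view_of I (\<lambda>_. []) [] i)}\<rparr>"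

(* The configuration after one step in which the active stations have flipped the coins r.
   Halted stations neither broadcast nor resume. *)
definition next_config :: "algorithm \<Rightarrow> input \<Rightarrow> config \<Rightarrow> (nat \<Rightarrow> bool list) \<Rightarrow> config" where
  "next_config A I c r =
     (let a = (\<lambda>i. choose_action A (view_of I (flips c) (channel c) i) (r i));
          f = (\<lambda>i. flips c i @ [r i]);
          h = channel c @ [channel_feedback I (active I c) a]
      in \<lparr>flips = f, channel = h,
          halted = halted c \<union> {i\<in>active I c. halts A (view_of I f h i)}\<rparr>)"

(* A terminated configuration does not change any more, so that the length of its
   channel history is the number of steps until termination. *)
definition step :: "algorithm \<Rightarrow> input \<Rightarrow> config \<Rightarrow> config pmf" where
  "step A I c =
     (if terminated I c then return_pmf c
      else map_pmf (next_config A I c)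
             (Pi_pmf (active I c) []
                (\<lambda>i. fair_coins (coin_count A (view_of I (flips c) (channel c) i)))))"

primrec run :: "algorithm \<Rightarrow> input \<Rightarrow> nat \<Rightarrow> config pmf" where
  "run A I 0 = return_pmf (initial A I)"
| "run A I (Suc t) = bind_pmf (run A I t) (step A I)"

definition revealed :: "config \<Rightarrow> edge set" where
  "revealed c = {e. \<exists>xs. Heard (Message (Some e) xs) \<in> set (channel c)}"

definition finds_min_spanning_forest :: "algorithm \<Rightarrow> input \<Rightarrow> bool" where
  "finds_min_spanning_forest A I \<longleftrightarrow>
     (\<forall>t. \<forall>c\<in>set_pmf (run A I t). terminated I c \<longrightarrow>
        (\<exists>T. min_spanning_forest I T \<and> T \<subseteq> revealed c))"

definition terminates_within :: "algorithm \<Rightarrow> input \<Rightarrow> nat \<Rightarrow> bool" where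
  "terminates_within A I b \<longleftrightarrow> (\<forall>c\<in>set_pmf (run A I b). terminated I c)"

(* With \<tau> the (possibly infinite) number of steps until termination, the integral below
   is the expectation of min \<tau> t; the supremum is the expectation of \<tau> by monotone
   convergence, and it is infinite if termination fails with positive probability. *)
definition expected_time :: "algorithm \<Rightarrow> input \<Rightarrow> ennreal" where
  "expected_time A I =
     (SUP t. \<integral>\<^sup>+ c. of_nat (length (channel c)) \<partial>measure_pmf (run A I t))"

end

(* Kruskal's algorithm driven by a backoff protocol. Candidates transmit with probability 2^-l at
   a common level l, which a collision raises and a silence lowers; silence at level 0 proves that
   no candidates are left. A search phase uses this to find the least weight of an edge that the
   current forest does not span: candidates are the unspanned edges lighter than the best one heard,
   and each announcement halves their number with probability 1/2. A collect phase then adds edges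
   of that weight as long as unspanned ones remain. With s candidates the level drifts towards
   log s, where an announcement has constant probability, so a phase takes O(log m) expected steps
   plus O(1) per edge added. Every other step belongs to a round robin through the identifiers,
   whose first silence shows that all edges have been revealed; this bounds the worst case. Every
   decision depends only on the channel history and fresh coins, so one potential function suffices
   for the expectation, and no independence of past coins is needed. *)

theory Submission
  imports Defs
begin

section \<open>Spanned edges and minimum-weight forests\<close>

text \<open>The potential is measured against an arbitrary minimum-weight spanning forest
  \<open>T\<close>, which the run need not build. Matroid exchange links the two: a least unspanned
  edge always shares its weight with an unspanned edge of \<open>T\<close>, so each collection uses
  up one weight of \<open>T\<close>, and the forest built never has more than \<open>card T\<close>
  edges. The obstacle is that the target of the level moves: one announcement may remove many
  candidates, and the level is then far too high. The potential therefore holds twice the target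
  besides twice the distance to it; a falling target cannot raise this sum. As a phase ends only at
  level 0, the distance at the start of the next one is at most the binary length of the number of
  edges. Near the target an announcement has only a tiny constant probability, so its gain is made
  as large as the inverse of that probability demands. Then every backoff step lowers the potential
  by at least 1 in expectation, elapsed time plus a suitably doubled potential is a supermartingale,
  and its initial value bounds the expected time.\<close>

definition adj :: "edge set \<Rightarrow> (nat \<times> nat) set" where
  "adj F = {(u, v). {u, v} \<in> F}"

text \<open>Closure in the graphic matroid: for an edge of two vertices it says that
  \<open>F\<close> joins its ends. Closure and \<open>indep\<close> let exchange arguments replace
  the handling of cycles.\<close>

definition spanned :: "edge set \<Rightarrow> edge set" where
  "spanned F = {e. \<forall>u\<in>e. \<forall>v\<in>e. (u, v) \<in> (adj F)\<^sup>*}"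

definition indep :: "edge set \<Rightarrow> bool" where
  "indep F \<longleftrightarrow> (\<forall>e\<in>F. e \<notin> spanned (F - {e}))"

lemma adj_mono: "F \<subseteq> G \<Longrightarrow> adj F \<subseteq> adj G"
  by (auto simp: adj_def)

lemma sym_adj_rtrancl: "(u, v) \<in> (adj F)\<^sup>* \<longleftrightarrow> (v, u) \<in> (adj F)\<^sup>*"
proof -
  have "sym (adj F)" by (auto simp: sym_def adj_def insert_commute)
  then have "sym ((adj F)\<^sup>*)" by (rule sym_rtrancl)
  then show ?thesis by (meson symD)
qed

lemma spanned_pair: "{u, v} \<in> spanned F \<longleftrightarrow> (u, v) \<in> (adj F)\<^sup>*"
  using sym_adj_rtrancl by (auto simp: spanned_def)

lemma spanned_mono: "F \<subseteq> G \<Longrightarrow> spanned F \<subseteq> spanned G"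
  unfolding spanned_def using rtrancl_mono[OF adj_mono] by blast

lemma spanned_superset:
  assumes "\<forall>e\<in>F. card e = 2"
  shows "F \<subseteq> spanned F"
proof
  fix e assume e: "e \<in> F"
  with assms obtain u v where "e = {u, v}" by (meson card_2_iff)
  with e show "e \<in> spanned F" by (auto simp: spanned_pair adj_def)
qed

lemma spanned_trans:
  assumes "G \<subseteq> spanned F"
  shows "spanned G \<subseteq> spanned F"
proof -
  have "adj G \<subseteq> (adj F)\<^sup>*"
    using assms spanned_pair[of _ _ F] by (auto simp: adj_def[of G])
  then have "(adj G)\<^sup>* \<subseteq> (adj F)\<^sup>*"
    by (rule rtrancl_subset_rtrancl)
  then show ?thesis
    unfolding spanned_def by blast
qed

text \<open>Further crossings of the new edge can be cut out of a walk, which leaves at most one, in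
  either direction.\<close>

lemma rtrancl_insert_edge:
  assumes "(a, b) \<in> (adj (insert {x, y} F))\<^sup>*"
  shows "(a, b) \<in> (adj F)\<^sup>* \<or>
    (a, x) \<in> (adj F)\<^sup>* \<and> (y, b) \<in> (adj F)\<^sup>* \<or>
    (a, y) \<in> (adj F)\<^sup>* \<and> (x, b) \<in> (adj F)\<^sup>*"
  using assms
proof (induction rule: rtrancl_induct)
  case base
  then show ?case by simp
next
  case (step b c)
  then consider "(b, c) \<in> adj F" | "b = x" "c = y" | "b = y" "c = x"
    by (auto simp: adj_def doubleton_eq_iff)
  then show ?case
  proof cases
    case 1
    with step.IH show ?thesis by (meson rtrancl.rtrancl_into_rtrancl)
  next
    case 2
    with step.IH show ?thesis using sym_adj_rtrancl[of x y F] by (auto dest: rtrancl_trans)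
  next
    case 3
    with step.IH show ?thesis using sym_adj_rtrancl[of x y F] by (auto dest: rtrancl_trans)
  qed
qed

text \<open>Mac Lane-Steinitz exchange: the path between the ends of \<open>f\<close> must cross
  \<open>e\<close>; its remaining pieces and \<open>f\<close> itself form a detour around
  \<open>e\<close>.\<close>

lemma spanned_exchange:
  assumes f: "f \<in> spanned (insert e F)" "f \<notin> spanned F" and "card e = 2" "card f = 2"
  shows "e \<in> spanned (insert f F)"
proof -
  obtain x y a b where e: "e = {x, y}" and fe: "f = {a, b}"
    using assms by (meson card_2_iff)
  let ?R = "(adj (insert f F))\<^sup>*"
  have sub: "(adj F)\<^sup>* \<subseteq> ?R"
    by (intro rtrancl_mono adj_mono) auto
  have ab: "(a, b) \<in> ?R" "(b, a) \<in> ?R"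
    by (auto simp: adj_def fe insert_commute)
  have "(a, x) \<in> (adj F)\<^sup>* \<and> (y, b) \<in> (adj F)\<^sup>* \<or>
    (a, y) \<in> (adj F)\<^sup>* \<and> (x, b) \<in> (adj F)\<^sup>*"
    using rtrancl_insert_edge[of a b x y F] f by (auto simp: e fe spanned_pair)
  then have "(a, x) \<in> ?R \<and> (b, y) \<in> ?R \<or> (a, y) \<in> ?R \<and> (b, x) \<in> ?R"
    using sub sym_adj_rtrancl by blast
  then have "(x, y) \<in> ?R"
    using ab sym_adj_rtrancl[of _ _ "insert f F"] by (meson rtrancl_trans)
  then show ?thesis by (simp add: e spanned_pair)
qed

lemma spanned_exchange_Diff:
  assumes "f \<in> F" "e \<in> spanned F" "e \<notin> spanned (F - {f})" "card e = 2" "card f = 2"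
  shows "f \<in> spanned (insert e (F - {f}))"
  using spanned_exchange[of e f "F - {f}"] assms by (simp add: insert_absorb)

lemma indep_subset: "indep F \<Longrightarrow> G \<subseteq> F \<Longrightarrow> indep G"
  unfolding indep_def by (meson Diff_mono in_mono spanned_mono subset_refl)

text \<open>Were an old edge \<open>f\<close> spanned by the others together with \<open>e\<close>,
  exchange would put \<open>e\<close> into the span of \<open>F\<close>.\<close>

lemma indep_insert:
  assumes F: "indep F" and e: "e \<notin> spanned F" and c: "\<forall>f\<in>insert e F. card f = 2"
  shows "indep (insert e F)"
  unfolding indep_def
proof
  fix f assume f: "f \<in> insert e F"
  have eF: "e \<notin> F" using e c spanned_superset[of F] by auto
  show "f \<notin> spanned (insert e F - {f})"
  proof (cases "f = e")
    case True
    then show ?thesis using e eF by simp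
  next
    case False
    with f have fF: "f \<in> F" and eq: "insert e F - {f} = insert e (F - {f})" by auto
    show ?thesis
    proof
      assume "f \<in> spanned (insert e F - {f})"
      then have "e \<in> spanned (insert f (F - {f}))"
        using F fF c spanned_exchange[of f e "F - {f}"] unfolding eq indep_def by simp
      then show False using e fF by (simp add: insert_absorb)
    qed
  qed
qed

text \<open>Steinitz exchange: each edge of \<open>F\<close> outside \<open>T\<close> is traded for
  one of \<open>T\<close>, keeping independence and size, until only edges of \<open>T\<close>
  remain.\<close>

lemma card_indep_le:
  assumes "indep F" "F \<subseteq> spanned T" "finite F" "finite T" "\<forall>f\<in>F \<union> T. card f = 2"
  shows "card F \<le> card T"
  using assms
proof (induction "card (F - T)" arbitrary: F)
  case 0
  then have "F \<subseteq> T" by auto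
  then show ?case using 0 by (simp add: card_mono)
next
  case (Suc k)
  then obtain e where e: "e \<in> F" "e \<notin> T"
    by (metis card.empty DiffD1 DiffD2 ex_in_conv nat.distinct(1))
  \<comment> \<open>Otherwise \<open>e\<close>, which \<open>T\<close> spans, would be spanned by
    the rest of \<open>F\<close>.\<close>
  have "\<not> T \<subseteq> spanned (F - {e})"
    using Suc.prems e spanned_trans unfolding indep_def by blast
  then obtain f where f: "f \<in> T" "f \<notin> spanned (F - {e})" by blast
  have fF: "f \<notin> F - {e}"
    using f spanned_superset[of "F - {e}"] Suc.prems by auto
  let ?G = "insert f (F - {e})"
  have "?G - T = (F - T) - {e}" using f by auto
  then have "card (?G - T) = k" using Suc.hyps(2) e Suc.prems by simp
  moreover have "indep ?G"
    using Suc.prems f by (intro indep_insert) (auto intro: indep_subset)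
  moreover have "?G \<subseteq> spanned T"
    using Suc.prems f spanned_superset[of T] by auto
  ultimately have "card ?G \<le> card T"
    using Suc.prems f by (intro Suc.hyps(1)) auto
  moreover have "card ?G = card F"
    using fF Suc.prems e card_Suc_Diff1[of F e] by (simp del: card_Diff_insert)
  ultimately show ?case by simp
qed

lemma rtrancl_simple_path:
  assumes "(u, v) \<in> R\<^sup>*"
  shows "\<exists>xs. xs \<noteq> [] \<and> distinct xs \<and> hd xs = u \<and> last xs = v \<and>
    (\<forall>i. Suc i < length xs \<longrightarrow> (xs ! i, xs ! Suc i) \<in> R)"
  using assms
proof (induction rule: rtrancl_induct)
  case base
  show ?case by (intro exI[of _ "[u]"]) auto
next
  case (step y z)
  then obtain xs where xs: "xs \<noteq> []" "distinct xs" "hd xs = u" "last xs = y"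
    "\<forall>i. Suc i < length xs \<longrightarrow> (xs ! i, xs ! Suc i) \<in> R" by blast
  show ?case
  proof (cases "z \<in> set xs")
    case True
    then obtain k where k: "k < length xs" "xs ! k = z" by (meson in_set_conv_nth)
    have "last (take (Suc k) xs) = z"
      using k by (simp add: take_Suc_conv_app_nth)
    then show ?thesis
      using xs k by (intro exI[of _ "take (Suc k) xs"]) (auto simp: hd_conv_nth)
  next
    case False
    have "((xs @ [z]) ! i, (xs @ [z]) ! Suc i) \<in> R" if "Suc i < length (xs @ [z])" for i
    proof (cases "Suc i < length xs")
      case True
      then show ?thesis using xs by (simp add: nth_append)
    next
      case False
      then have "i = length xs - 1" using that by simp
      then show ?thesis using xs step(2) by (simp add: nth_append last_conv_nth)
    qed
    then show ?thesis using xs False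
      by (intro exI[of _ "xs @ [z]"]) auto
  qed
qed

text \<open>An edge spanned by the others closes a simple path to a cycle; conversely, the closing
  edge of a cycle is spanned by the path through its other edges.\<close>

lemma acyclic_edges_iff_indep:
  assumes c: "\<forall>e\<in>F. card e = 2"
  shows "acyclic_edges F \<longleftrightarrow> indep F"
proof
  assume ac: "acyclic_edges F"
  show "indep F"
    unfolding indep_def
  proof (intro ballI notI)
    fix e assume e: "e \<in> F" and sp: "e \<in> spanned (F - {e})"
    obtain u v where uv: "e = {u, v}" "u \<noteq> v" using e c by (meson card_2_iff)
    then obtain xs where xs: "xs \<noteq> []" "distinct xs" "hd xs = u" "last xs = v"
      "\<forall>i. Suc i < length xs \<longrightarrow> (xs ! i, xs ! Suc i) \<in> adj (F - {e})"
      using sp rtrancl_simple_path[of u v "adj (F - {e})"] by (auto simp: spanned_pair)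
    have ends: "xs ! 0 = u" "xs ! (length xs - 1) = v"
      using xs by (auto simp: hd_conv_nth last_conv_nth)
    have "length xs \<noteq> 1" using ends uv by auto
    \<comment> \<open>A path on two vertices would be the edge \<open>e\<close> itself, which is
      removed.\<close>
    moreover have "length xs \<noteq> 2"
      using xs(5)[rule_format, of 0] ends uv by (auto simp: adj_def)
    ultimately have len: "length xs \<ge> 3"
      using xs(1) by (cases "length xs") (auto simp: numeral_eq_Suc le_Suc_eq)
    have "{xs ! i, xs ! (Suc i mod length xs)} \<in> F" if "i < length xs" for i
    proof (cases "Suc i < length xs")
      case True
      then show ?thesis using xs(5) by (auto simp: adj_def)
    next
      case False
      then have "i = length xs - 1" "Suc i = length xs" using that by auto
      then show ?thesis using ends e uv by (simp add: insert_commute)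
    qed
    then show False using ac xs len unfolding acyclic_edges_def by blast
  qed
next
  assume ind: "indep F"
  show "acyclic_edges F"
    unfolding acyclic_edges_def
  proof
    assume "\<exists>vs. length vs \<ge> 3 \<and> distinct vs \<and>
          (\<forall>i<length vs. {vs ! i, vs ! (Suc i mod length vs)} \<in> F)"
    then obtain vs where vs: "length vs \<ge> 3" "distinct vs"
      "\<And>i. i < length vs \<Longrightarrow> {vs ! i, vs ! (Suc i mod length vs)} \<in> F" by blast
    let ?n = "length vs - 1"
    let ?e = "{vs ! ?n, vs ! 0}"
    have e: "?e \<in> F" using vs(3)[of ?n] vs(1) by (cases "length vs") auto
    have "(vs ! 0, vs ! i) \<in> (adj (F - {?e}))\<^sup>*" if "i \<le> ?n" for i
      using that
    proof (induction i)
      case (Suc i)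
      have "Suc i < length vs" using Suc.prems vs(1) by simp
      then have "{vs ! i, vs ! Suc i} \<in> F" using vs(3)[of i] by simp
      moreover have "{vs ! i, vs ! Suc i} \<noteq> ?e"
      proof
        assume "{vs ! i, vs ! Suc i} = ?e"
        then consider "vs ! i = vs ! ?n" | "vs ! i = vs ! 0" "vs ! Suc i = vs ! ?n"
          by (auto simp: doubleton_eq_iff)
        then show False
        proof cases
          case 1
          then have "i = ?n" using Suc.prems vs
            by (subst (asm) nth_eq_iff_index_eq) auto
          then show False using Suc.prems by simp
        next
          case 2
          moreover have "vs \<noteq> []" using vs(1) by auto
          ultimately have "i = 0" "Suc i = ?n"
            using \<open>Suc i < length vs\<close> vs(1,2)
              nth_eq_iff_index_eq[of vs i 0] nth_eq_iff_index_eq[of vs "Suc i" ?n] by auto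
          then show False using vs(1) by simp
        qed
      qed
      ultimately have "(vs ! i, vs ! Suc i) \<in> adj (F - {?e})" by (simp add: adj_def)
      then show ?case using Suc by (meson Suc_leD rtrancl.rtrancl_into_rtrancl)
    qed simp
    from this[of ?n] have "?e \<in> spanned (F - {?e})"
      using sym_adj_rtrancl by (simp add: spanned_pair)
    then show False using ind e unfolding indep_def by blast
  qed
qed

section \<open>Lightness, a local criterion for minimum weight\<close>

definition light :: "input \<Rightarrow> edge set \<Rightarrow> edge set \<Rightarrow> bool" where
  "light I E F \<longleftrightarrow> (\<forall>e\<in>E. e \<in> spanned {f\<in>F. weight I f \<le> weight I e})"

lemma valid_input_card: "valid_input I \<Longrightarrow> e \<in> edges I \<Longrightarrow> card e = 2"
  by (auto simp: valid_input_def)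

lemma valid_input_finite: "valid_input I \<Longrightarrow> finite (edges I)"
  unfolding valid_input_def stations_def by (metis bij_betw_finite finite_atLeastAtMost)

lemma spanning_forest_iff:
  assumes c: "\<forall>e\<in>E. card e = 2"
  shows "spanning_forest E F \<longleftrightarrow> F \<subseteq> E \<and> indep F \<and> E \<subseteq> spanned F"
proof
  assume sf: "spanning_forest E F"
  then have FE: "F \<subseteq> E" and i: "indep F"
    using c acyclic_edges_iff_indep[of F] unfolding spanning_forest_def by auto
  have "e \<in> spanned F" if "e \<in> E" for e
  proof (rule ccontr)
    assume n: "e \<notin> spanned F"
    then have "indep (insert e F)" using i c FE that by (intro indep_insert) auto
    then have "acyclic_edges (insert e F)"
      using c FE that acyclic_edges_iff_indep[of "insert e F"] by auto
    then have "insert e F = F" using sf FE that unfolding spanning_forest_def by blast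
    then show False using n spanned_superset[of F] c FE by auto
  qed
  then show "F \<subseteq> E \<and> indep F \<and> E \<subseteq> spanned F" using FE i by auto
next
  assume r: "F \<subseteq> E \<and> indep F \<and> E \<subseteq> spanned F"
  have "F' = F" if F': "F \<subseteq> F'" "F' \<subseteq> E" "acyclic_edges F'" for F'
  proof (rule ccontr)
    assume "F' \<noteq> F"
    then obtain e where e: "e \<in> F'" "e \<notin> F" using F' by auto
    have "indep F'" using F' c acyclic_edges_iff_indep[of F'] by auto
    then have "e \<notin> spanned (F' - {e})" using e unfolding indep_def by auto
    moreover have "spanned F \<subseteq> spanned (F' - {e})" using e F' by (intro spanned_mono) auto
    ultimately show False using r e F' by auto
  qed
  then show "spanning_forest E F"
    using r c acyclic_edges_iff_indep[of F] unfolding spanning_forest_def by auto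
qed

lemma spanning_forest_swap:
  assumes c: "\<forall>e\<in>E. card e = 2" and T: "spanning_forest E T"
    and f: "f \<in> T" and e: "e \<in> E" "e \<notin> spanned (T - {f})"
  shows "spanning_forest E (insert e (T - {f}))"
proof -
  have T': "T \<subseteq> E" "indep T" "E \<subseteq> spanned T" using T spanning_forest_iff[OF c] by auto
  let ?G = "insert e (T - {f})"
  have "f \<in> spanned ?G"
    using T' e f c by (intro spanned_exchange_Diff) auto
  moreover have "T - {f} \<subseteq> spanned ?G"
    using spanned_superset[of ?G] T' c e by auto
  ultimately have "T \<subseteq> spanned ?G" by auto
  then have "E \<subseteq> spanned ?G" using T' spanned_trans by blast
  moreover have "indep ?G"
    using T' e c by (intro indep_insert) (auto intro: indep_subset)
  ultimately show ?thesis using spanning_forest_iff[OF c] T' e by auto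
qed

text \<open>If the edges of \<open>T\<close> no heavier than \<open>e\<close> fail to span
  \<open>e\<close>, some heavier \<open>f\<close> on the path between its ends can be swapped for
  \<open>e\<close>, which lowers the total weight.\<close>

lemma min_spanning_forest_light:
  assumes v: "valid_input I" and T: "min_spanning_forest I T"
  shows "light I (edges I) T"
  unfolding light_def
proof
  fix e assume e: "e \<in> edges I"
  have c: "\<forall>e\<in>edges I. card e = 2" using v by (simp add: valid_input_card)
  have sf: "spanning_forest (edges I) T" using T by (simp add: min_spanning_forest_def)
  then have T': "T \<subseteq> edges I" "indep T" "edges I \<subseteq> spanned T"
    using spanning_forest_iff[OF c] by auto
  have fT: "finite T" using T' v valid_input_finite finite_subset by blast
  let ?L = "{f\<in>T. weight I f \<le> weight I e}"
  show "e \<in> spanned ?L"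
  proof (rule ccontr)
    assume n: "e \<notin> spanned ?L"
    \<comment> \<open>A smallest \<open>Y\<close> between \<open>?L\<close> and \<open>T\<close>
      that still spans \<open>e\<close> plays the part of the path in \<open>T\<close>: any
      \<open>f\<close> in \<open>Y\<close> outside \<open>?L\<close> is heavier than
      \<open>e\<close> and cannot be left out of \<open>Y\<close>.\<close>
    let ?P = "\<lambda>Y. ?L \<subseteq> Y \<and> Y \<subseteq> T \<and> e \<in> spanned Y"
    have "?P T" using T' e by auto
    obtain Y where "?P Y \<and> (\<forall>Z. ?P Z \<longrightarrow> card Y \<le> card Z)"
      using ex_has_least_nat[of ?P T card, OF \<open>?P T\<close>] by (rule exE)
    then have Y: "?P Y" and Ymin: "?P Z \<Longrightarrow> card Y \<le> card Z" for Z
      by simp_all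
    have "Y \<noteq> ?L" using Y n by auto
    then obtain f where f: "f \<in> Y" "f \<notin> ?L" using Y by auto
    have "finite Y" using Y fT finite_subset by blast
    then have "card (Y - {f}) < card Y" using f by (intro card_Diff1_less) auto
    then have "\<not> ?P (Y - {f})" using Ymin[of "Y - {f}"] by linarith
    then have "e \<notin> spanned (Y - {f})" using Y f by blast
    then have "f \<in> spanned (insert e (Y - {f}))"
      using Y f c e T' by (intro spanned_exchange_Diff) auto
    then have fs: "f \<in> spanned (insert e (T - {f}))"
      using spanned_mono[of "insert e (Y - {f})" "insert e (T - {f})"] Y by auto
    have fTn: "f \<in> T" "f \<notin> spanned (T - {f})" using T' f Y unfolding indep_def by auto
    \<comment> \<open>If \<open>T - {f}\<close> spanned \<open>e\<close>, then by \<open>fs\<close>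
      it would also span \<open>f\<close>, against independence.\<close>
    have es: "e \<notin> spanned (T - {f})"
    proof
      assume "e \<in> spanned (T - {f})"
      then have "insert e (T - {f}) \<subseteq> spanned (T - {f})"
        using spanned_superset[of "T - {f}"] c T' by auto
      then show False using fs fTn spanned_trans by blast
    qed
    have sf': "spanning_forest (edges I) (insert e (T - {f}))"
      by (rule spanning_forest_swap[OF c sf]) (use fTn e es in auto)
    have "e \<notin> T - {f}" using es spanned_superset[of "T - {f}"] c T' by auto
    then have "sum (weight I) (insert e (T - {f})) = weight I e + (sum (weight I) T - weight I f)"
      using fT fTn by (simp add: sum_diff1)
    moreover have "weight I e < weight I f" using f Y by auto
    ultimately have "sum (weight I) (insert e (T - {f})) < sum (weight I) T" by simp
    then show False using T sf' unfolding min_spanning_forest_def by fastforce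
  qed
qed

lemma spanning_forest_exists:
  assumes "finite E" "\<forall>e\<in>E. card e = 2"
  shows "\<exists>F. spanning_forest E F"
proof -
  let ?P = "\<lambda>F. F \<subseteq> E \<and> acyclic_edges F"
  have "?P {}" using acyclic_edges_iff_indep[of "{}"] by (simp add: indep_def)
  moreover have "\<forall>F. ?P F \<longrightarrow> card F < Suc (card E)"
    using assms by (simp add: card_mono less_Suc_eq_le)
  ultimately obtain F where F: "?P F" "\<And>G. ?P G \<Longrightarrow> card G \<le> card F"
    using ex_has_greatest_nat[of ?P "{}" card "Suc (card E)"] by blast
  have "F' = F" if "F \<subseteq> F'" "F' \<subseteq> E" "acyclic_edges F'" for F'
    using that F assms finite_subset[of F' E] by (metis card_seteq)
  then show ?thesis using F unfolding spanning_forest_def by blast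
qed

lemma min_spanning_forest_exists:
  assumes v: "valid_input I"
  shows "\<exists>T. min_spanning_forest I T"
proof -
  let ?S = "{F. spanning_forest (edges I) F}"
  have "finite ?S"
    using valid_input_finite[OF v]
    by (intro finite_subset[of ?S "Pow (edges I)"]) (auto simp: spanning_forest_def)
  moreover have "?S \<noteq> {}"
    using spanning_forest_exists valid_input_finite[OF v] valid_input_card[OF v] by blast
  ultimately have "arg_min_on (sum (weight I)) ?S \<in> ?S"
    "\<not> (\<exists>F\<in>?S. sum (weight I) F < sum (weight I) (arg_min_on (sum (weight I)) ?S))"
    by (rule arg_min_if_finite)+
  then show ?thesis unfolding min_spanning_forest_def by (auto simp: not_less)
qed

text \<open>A minimum-weight forest sharing the most edges with \<open>F\<close> must equal
  \<open>F\<close>: for an edge \<open>f\<close> of it outside \<open>F\<close>, lightness offers an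
  edge of \<open>F\<close> no heavier than \<open>f\<close> that can be swapped in.\<close>

lemma light_min_spanning_forest:
  assumes v: "valid_input I" and F: "spanning_forest (edges I) F" and l: "light I (edges I) F"
  shows "min_spanning_forest I F"
proof -
  have c: "\<forall>e\<in>edges I. card e = 2" using v by (simp add: valid_input_card)
  have F': "F \<subseteq> edges I" using F by (simp add: spanning_forest_def)
  then have fF: "finite F" using valid_input_finite[OF v] finite_subset by blast
  obtain T0 where "min_spanning_forest I T0" using min_spanning_forest_exists[OF v] by blast
  moreover have "\<forall>T. min_spanning_forest I T \<longrightarrow> card (T \<inter> F) < Suc (card F)"
    using fF by (simp add: card_mono less_Suc_eq_le)
  ultimately have "\<exists>T. min_spanning_forest I T \<and>
      (\<forall>G. min_spanning_forest I G \<longrightarrow> card (G \<inter> F) \<le> card (T \<inter> F))"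
    by (rule ex_has_greatest_nat)
  then obtain T where T: "min_spanning_forest I T"
    and Tmax: "min_spanning_forest I G \<Longrightarrow> card (G \<inter> F) \<le> card (T \<inter> F)" for G
    by auto
  have sf: "spanning_forest (edges I) T" using T by (simp add: min_spanning_forest_def)
  then have T': "T \<subseteq> edges I" "indep T" "edges I \<subseteq> spanned T"
    using spanning_forest_iff[OF c] by auto
  have fT: "finite T" using T' v valid_input_finite finite_subset by blast
  have "T \<subseteq> F"
  proof (rule ccontr)
    assume "\<not> T \<subseteq> F"
    then obtain f where f: "f \<in> T" "f \<notin> F" by blast
    let ?L = "{g\<in>F. weight I g \<le> weight I f}"
    have "f \<in> spanned ?L" using l f T' unfolding light_def by auto
    moreover have "f \<notin> spanned (T - {f})" using T' f unfolding indep_def by auto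
    ultimately have "\<not> ?L \<subseteq> spanned (T - {f})" using spanned_trans by blast
    then obtain e where e: "e \<in> F" "weight I e \<le> weight I f" "e \<notin> spanned (T - {f})" by auto
    let ?G = "insert e (T - {f})"
    have eT: "e \<notin> T - {f}" using e spanned_superset[of "T - {f}"] c T' by auto
    have sf': "spanning_forest (edges I) ?G"
      by (rule spanning_forest_swap[OF c sf]) (use f e F' in auto)
    have "sum (weight I) ?G = weight I e + (sum (weight I) T - weight I f)"
      using fT f eT by (simp add: sum_diff1)
    then have "sum (weight I) ?G \<le> sum (weight I) T" using e by simp
    then have "min_spanning_forest I ?G"
      using T sf' unfolding min_spanning_forest_def by (meson order_trans)
    then have "card (?G \<inter> F) \<le> card (T \<inter> F)" by (rule Tmax)
    moreover have "?G \<inter> F = insert e (T \<inter> F)" "e \<notin> T \<inter> F" using e f eT by auto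
    ultimately show False using fT by simp
  qed
  then have "F = T" using sf F unfolding spanning_forest_def by blast
  then show ?thesis using T by simp
qed

section \<open>Random sets of senders\<close>

lemma finite_fair_coins: "finite {bs :: bool list. length bs = k}"
  using finite_lists_length_eq[of "UNIV :: bool set" k] by simp

lemma card_fair_coins: "card {bs :: bool list. length bs = k} = 2 ^ k"
  using card_lists_length_eq[of "UNIV :: bool set" k] by simp

lemma nonempty_fair_coins: "{bs :: bool list. length bs = k} \<noteq> {}"
  by (metis card_fair_coins card.empty power_not_zero zero_neq_numeral)

lemma set_pmf_fair_coins: "set_pmf (fair_coins k) = {bs. length bs = k}"
  unfolding fair_coins_def
  by (rule set_pmf_of_set) (use finite_fair_coins nonempty_fair_coins in auto)

lemma prob_all_heads: "measure_pmf.prob (fair_coins k) {bs. \<forall>b\<in>set bs. b} = (1 / 2) ^ k"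
proof -
  have "{bs :: bool list. length bs = k} \<inter> {bs. \<forall>b\<in>set bs. b} = {replicate k True}"
    by (auto intro!: replicate_eqI)
  then show ?thesis
    unfolding fair_coins_def using measure_pmf_of_set[OF nonempty_fair_coins finite_fair_coins, of k]
    by (simp add: card_fair_coins power_one_over)
qed

lemma prob_not_all_heads:
  "measure_pmf.prob (fair_coins k) {bs. \<not> (\<forall>b\<in>set bs. b)} = 1 - (1 / 2) ^ k"
proof -
  have "{bs :: bool list. \<not> (\<forall>b\<in>set bs. b)} = UNIV - {bs. \<forall>b\<in>set bs. b}" by auto
  then show ?thesis
    using measure_pmf.prob_compl[of "{bs. \<forall>b\<in>set bs. b}" "fair_coins k"]
    by (simp add: prob_all_heads)
qed

text \<open>One number of coins serves all stations because the level is read off the public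
  channel.\<close>

definition flip_all :: "nat set \<Rightarrow> nat \<Rightarrow> (nat \<Rightarrow> bool list) pmf" where
  "flip_all S k = Pi_pmf S [] (\<lambda>_. fair_coins k)"

text \<open>With no coins the condition is vacuous, so at level 0 all of \<open>K\<close> send; this
  makes silence at level 0 conclusive.\<close>

definition senders :: "nat set \<Rightarrow> (nat \<Rightarrow> bool list) \<Rightarrow> nat set" where
  "senders K r = {i\<in>K. \<forall>b\<in>set (r i). b}"

lemma finite_set_flip_all: "finite S \<Longrightarrow> finite (set_pmf (flip_all S k))"
  unfolding flip_all_def
  by (subst set_Pi_pmf) (auto intro!: finite_PiE_dflt simp: set_pmf_fair_coins finite_fair_coins)

lemma prob_senders_eq:
  assumes "finite S" "K \<subseteq> S" "B \<subseteq> K"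
  shows "measure_pmf.prob (flip_all S k) {r. senders K r = B} =
    ((1 / 2) ^ k) ^ card B * (1 - (1 / 2) ^ k) ^ (card K - card B)"
proof -
  let ?A = "\<lambda>i. if i \<in> B then {bs. \<forall>b\<in>set bs. b}
    else if i \<in> K then {bs. \<not> (\<forall>b\<in>set bs. b)} else UNIV"
  have fK: "finite K" "finite B"
    using assms by (meson finite_subset order_trans)+
  have "measure_pmf.prob (flip_all S k) {r. senders K r = B} =
      measure_pmf.prob (flip_all S k) (PiE_dflt S [] ?A)"
  proof (rule measure_pmf.finite_measure_eq_AE)
    show "AE r in flip_all S k. r \<in> {r. senders K r = B} \<longleftrightarrow> r \<in> PiE_dflt S [] ?A"
    proof (rule AE_pmfI)
      fix r assume "r \<in> set_pmf (flip_all S k)"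
      then have "r \<in> PiE_dflt S [] (\<lambda>_. {bs. length bs = k})"
        using assms by (simp add: flip_all_def set_Pi_pmf set_pmf_fair_coins comp_def)
      then have "r \<in> PiE_dflt S [] ?A \<longleftrightarrow> (\<forall>i\<in>S. r i \<in> ?A i)"
        unfolding PiE_dflt_def by blast
      also have "\<dots> \<longleftrightarrow> (\<forall>i\<in>K. i \<in> B \<longleftrightarrow> (\<forall>b\<in>set (r i). b))"
        using assms(2,3) by (auto simp: subset_iff)
      also have "\<dots> \<longleftrightarrow> senders K r = B"
        using assms(3) unfolding senders_def by blast
      finally show "r \<in> {r. senders K r = B} \<longleftrightarrow> r \<in> PiE_dflt S [] ?A" by simp
    qed
  qed auto
  also have "\<dots> = (\<Prod>i\<in>S. measure_pmf.prob (fair_coins k) (?A i))"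
    unfolding flip_all_def by (rule measure_Pi_pmf_PiE_dflt) fact
  also have "\<dots> = (\<Prod>i\<in>S. if i \<in> B then (1 / 2) ^ k
      else if i \<in> K then 1 - (1 / 2) ^ k else 1)"
    by (intro prod.cong refl) (simp add: prob_all_heads prob_not_all_heads[simplified])
  also have "\<dots> = (\<Prod>i\<in>K. if i \<in> B then (1 / 2) ^ k else 1 - (1 / 2) ^ k)"
    using assms by (intro prod.mono_neutral_cong_right) auto
  also have "\<dots> = (\<Prod>i\<in>B. (1 / 2) ^ k) * (\<Prod>i\<in>K - B. 1 - (1 / 2) ^ k)"
    using fK assms by (subst prod.subset_diff[of B K]) (auto intro!: prod.cong simp: mult.commute)
  also have "\<dots> = ((1 / 2) ^ k) ^ card B * (1 - (1 / 2) ^ k) ^ (card K - card B)"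
    using fK assms by (simp add: card_Diff_subset)
  finally show ?thesis .
qed

text \<open>Only the events of no sender and of one given sender need a probability, and collisions
  take the remaining mass. Writing the three cases as a combination of indicators reduces the claim
  to linearity.\<close>

lemma expectation_senders:
  fixes g :: "nat \<Rightarrow> real" and k :: nat
  assumes S: "finite S" "K \<subseteq> S"
  defines "p \<equiv> (1 / 2) ^ k"
  defines "q0 \<equiv> (1 - p) ^ card K" and "q1 \<equiv> p * (1 - p) ^ (card K - 1)"
  shows "measure_pmf.expectation (flip_all S k)
      (\<lambda>r. if senders K r = {} then a else if card (senders K r) = 1
        then g (the_elem (senders K r)) else b) =
    q0 * a + q1 * sum g K + (1 - q0 - q1 * card K) * b"
proof -
  let ?M = "measure_pmf (flip_all S k)"
  let ?E = "\<lambda>B. {r. senders K r = B}"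
  let ?I = "\<lambda>B r. indicator (?E B) r :: real"
  have fK: "finite K" using S by (meson finite_subset)
  have split: "(if senders K r = {} then a else if card (senders K r) = 1
        then g (the_elem (senders K r)) else b) =
      b + (a - b) * ?I {} r + (\<Sum>i\<in>K. (g i - b) * ?I {i} r)" for r
  proof -
    let ?B = "senders K r"
    have BK: "?B \<subseteq> K" by (auto simp: senders_def)
    consider "?B = {}" | i where "?B = {i}" | "card ?B \<noteq> 1" "?B \<noteq> {}"
      by (metis card_1_singletonE)
    then show ?thesis
    proof cases
      case 1
      then show ?thesis by simp
    next
      case 2
      then have "i \<in> K" using BK by auto
      have "(\<Sum>j\<in>K. (g j - b) * ?I {j} r) = (\<Sum>j\<in>K. if j = i then g i - b else 0)"
        using 2 by (intro sum.cong) (auto simp: indicator_def)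
      then show ?thesis using 2 \<open>i \<in> K\<close> fK by simp
    next
      case 3
      then have "\<And>i. ?B \<noteq> {i}" by auto
      then show ?thesis using 3 by simp
    qed
  qed
  have int: "integrable ?M f" for f :: "_ \<Rightarrow> real"
    using S by (intro integrable_measure_pmf_finite finite_set_flip_all)
  have P: "measure ?M (?E {}) = q0" "i \<in> K \<Longrightarrow> measure ?M (?E {i}) = q1" for i
    using prob_senders_eq[OF S] unfolding q0_def q1_def p_def by simp_all
  have "measure_pmf.expectation (flip_all S k)
      (\<lambda>r. if senders K r = {} then a else if card (senders K r) = 1
        then g (the_elem (senders K r)) else b) =
      b + (a - b) * q0 + (\<Sum>i\<in>K. (g i - b) * q1)"
    unfolding split
    by (subst Bochner_Integration.integral_add[OF int int]
          Bochner_Integration.integral_sum[OF int])+ (simp add: P)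
  also have "\<dots> = q0 * a + q1 * sum g K + (1 - q0 - q1 * card K) * b"
    by (simp add: sum_subtractf algebra_simps flip: sum_distrib_left)
  finally show ?thesis .
qed

section \<open>Binary length, the target of the backoff level, and ranks of candidates\<close>

definition bitlen :: "nat \<Rightarrow> nat" where
  "bitlen s = (LEAST l. s < 2 ^ l)"

lemma less_bitlen: "s < 2 ^ bitlen s"
  unfolding bitlen_def by (rule LeastI[of _ s]) simp

lemma bitlen_le: "s < 2 ^ l \<Longrightarrow> bitlen s \<le> l"
  unfolding bitlen_def by (rule Least_le)

lemma bitlen_0 [simp]: "bitlen 0 = 0"
  using bitlen_le[of 0 0] by simp

lemma bitlen_mono: "s \<le> t \<Longrightarrow> bitlen s \<le> bitlen t"
  by (meson bitlen_le less_bitlen order_le_less_trans)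

lemma bitlen_pos: "s > 0 \<Longrightarrow> bitlen s > 0"
  using less_bitlen[of s] by (cases "bitlen s") auto

lemma power_bitlen_le:
  assumes "s > 0"
  shows "2 ^ (bitlen s - 1) \<le> s"
proof (rule ccontr)
  assume "\<not> ?thesis"
  then have "bitlen s \<le> bitlen s - 1" by (intro bitlen_le) simp
  then show False using bitlen_pos[OF assms] by simp
qed

lemma bitlen_half:
  assumes "s > 0" "2 * t \<le> s"
  shows "bitlen t + 1 \<le> bitlen s"
proof -
  have "2 * t < 2 * 2 ^ (bitlen s - 1)"
    using assms less_bitlen[of s] bitlen_pos[of s]
    by (metis One_nat_def Suc_pred order_le_less_trans power_Suc)
  then have "bitlen t \<le> bitlen s - 1" by (intro bitlen_le) simp
  then show ?thesis using bitlen_pos[of s] assms by simp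
qed

lemma bitlen_le_log:
  assumes "s > 0"
  shows "real (bitlen s) \<le> log 2 s + 1"
proof -
  have "real (bitlen s - 1) = log 2 (2 ^ (bitlen s - 1))" by simp
  also have "\<dots> \<le> log 2 s"
    using power_bitlen_le[OF assms] assms
    by (subst log_le_cancel_iff) (auto simp flip: of_nat_power)
  finally show ?thesis using bitlen_pos[OF assms] by linarith
qed

text \<open>The lightest element outside the set on the right would have more than half of
  \<open>S\<close> strictly below it, all inside that set. Ties do no harm, as only strictly lighter
  elements are counted.\<close>

lemma many_small_ranks:
  fixes w :: "'a \<Rightarrow> real"
  assumes fS: "finite S"
  shows "card S \<le> 2 * card {i\<in>S. 2 * card {k\<in>S. w k < w i} \<le> card S}"
proof (rule ccontr)
  let ?lo = "\<lambda>i. {k\<in>S. w k < w i}"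
  let ?G = "{i\<in>S. 2 * card (?lo i) \<le> card S}"
  assume "\<not> ?thesis"
  then have n: "2 * card ?G < card S" by simp
  have "?G \<noteq> S" using n by auto
  then have ne: "S - ?G \<noteq> {}" by auto
  define i where "i = arg_min_on w (S - ?G)"
  have i: "i \<in> S - ?G" "\<not> (\<exists>k\<in>S - ?G. w k < w i)"
    using arg_min_if_finite[of "S - ?G" w] ne fS unfolding i_def by auto
  have "?lo i \<subseteq> ?G" using i(2) by blast
  then have "card (?lo i) \<le> card ?G" using fS by (intro card_mono) auto
  then show False using i(1) n by auto
qed

text \<open>Near its target the level makes the expected number of senders \<open>p * s\<close> lie
  between 1/4 and 16, and then \<open>p * s * (1 - p) ^ (s - 1)\<close> is at least
  \<open>1 / 4 * exp (- 2 * 16)\<close>.\<close>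

definition success_bound :: real where
  "success_bound = exp (- 32) / 4"

text \<open>Of the 3, two pay for the possible growth of the doubled distance and one is the drift
  required of each step.\<close>

definition backoff_gain :: real where
  "backoff_gain = 3 / success_bound"

section \<open>Probability estimates for one backoff step\<close>

lemma power_one_minus_ge:
  fixes p :: real
  assumes "0 \<le> p" "p \<le> 1 / 2"
  shows "exp (- 2 * (p * n)) \<le> (1 - p) ^ n"
proof -
  have "exp (- 2 * p) * (1 + 2 * p) \<le> 1"
  proof -
    have "exp (- 2 * p) * (1 + 2 * p) \<le> exp (- 2 * p) * exp (2 * p)"
      by (intro mult_left_mono) (auto simp: exp_ge_add_one_self)
    then show ?thesis by (simp flip: exp_add)
  qed
  moreover have "1 \<le> (1 - p) * (1 + 2 * p)"
    using mult_nonneg_nonneg[of p "1 - 2 * p"] assms by (simp add: algebra_simps)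
  ultimately have "exp (- 2 * p) * (1 + 2 * p) \<le> (1 - p) * (1 + 2 * p)" by linarith
  then have "exp (- 2 * p) \<le> 1 - p" using assms by (simp add: mult_le_cancel_right)
  then have "exp (- 2 * p) ^ n \<le> (1 - p) ^ n" by (intro power_mono) auto
  then show ?thesis by (simp add: exp_of_nat_mult[symmetric] algebra_simps)
qed

lemma power_one_minus_le:
  fixes p :: real
  assumes "0 \<le> p" "p \<le> 1"
  shows "(1 - p) ^ n \<le> exp (- (p * n))"
proof -
  have "1 - p \<le> exp (- p)" using exp_ge_add_one_self[of "- p"] by simp
  then have "(1 - p) ^ n \<le> exp (- p) ^ n" using assms by (intro power_mono) auto
  then show ?thesis by (simp add: exp_of_nat_mult[symmetric] algebra_simps)
qed

lemma success_bound_pos: "success_bound > 0"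
  by (simp add: success_bound_def)

lemma backoff_gain_success: "backoff_gain * success_bound = 3"
  using success_bound_pos by (simp add: backoff_gain_def)

lemma backoff_gain_ge: "backoff_gain \<ge> 3"
proof -
  have "exp (- 32) \<le> (1 :: real)" by simp
  then have "success_bound \<le> 1" unfolding success_bound_def by linarith
  then show ?thesis using success_bound_pos by (simp add: backoff_gain_def field_simps)
qed

text \<open>The summands are the probabilities of no sender and of exactly one, so the weight left
  for collisions is nonnegative. Bernoulli's inequality replaces \<open>1 + n * p\<close> by a
  power, and the product becomes a power of \<open>1 - p * p\<close>.\<close>

lemma binomial_tail_le_1:
  fixes p :: real
  assumes "0 \<le> p" "p \<le> 1" "s > 0"
  shows "(1 - p) ^ s + p * (1 - p) ^ (s - 1) * s \<le> 1"
proof -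
  obtain n where n: "s = Suc n" using assms by (cases s) auto
  have "(1 - p) ^ s + p * (1 - p) ^ (s - 1) * s = (1 - p) ^ n * (1 + n * p)"
    by (simp add: n algebra_simps)
  also have "\<dots> \<le> (1 - p) ^ n * (1 + p) ^ n"
    using assms Bernoulli_inequality[of p n] by (intro mult_left_mono) auto
  also have "\<dots> = (1 - p * p) ^ n"
    by (simp add: algebra_simps flip: power_mult_distrib)
  also have "\<dots> \<le> 1"
    using assms by (intro power_le_one) (auto simp: mult_le_one)
  finally show ?thesis .
qed

text \<open>The load \<open>(1 / 2) ^ j * s\<close> is the expected number of senders; the
  difference of \<open>bitlen s\<close> and the level fixes it up to a factor of 2.\<close>

lemma backoff_load:
  assumes "s > 0"
  shows "(1 / 2) ^ j * real s < 2 powr (real (bitlen s) - real j)"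
    and "2 powr (real (bitlen s) - 1 - real j) \<le> (1 / 2) ^ j * real s"
proof -
  have j: "(1 / 2 :: real) ^ j = 2 powr - real j"
    by (simp add: powr_minus powr_realpow power_one_over inverse_eq_divide)
  have "real s < 2 powr real (bitlen s)"
    using less_bitlen[of s] by (simp add: powr_realpow)
  then have "2 powr - real j * real s < 2 powr - real j * 2 powr real (bitlen s)"
    by (intro mult_strict_left_mono) auto
  then show "(1 / 2) ^ j * real s < 2 powr (real (bitlen s) - real j)"
    by (simp add: j flip: powr_add)
  have "2 powr real (bitlen s - 1) \<le> real s"
    using power_bitlen_le[OF assms] by (simp add: powr_realpow)
  moreover have "real (bitlen s - 1) = real (bitlen s) - 1"
    using bitlen_pos[OF assms] by simp
  ultimately have "2 powr - real j * 2 powr (real (bitlen s) - 1) \<le> 2 powr - real j * real s"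
    by (intro mult_left_mono) auto
  then show "2 powr (real (bitlen s) - 1 - real j) \<le> (1 / 2) ^ j * real s"
    by (simp add: j flip: powr_add)
qed

text \<open>With the load as \<open>t\<close>, the left side dominates the probability of at most
  one sender. Load 16 is reached at levels five or more below \<open>bitlen s\<close>.\<close>

lemma collision_tail:
  fixes t :: real
  assumes "t \<ge> 16"
  shows "(1 + 2 * t) * exp (- t) \<le> 1 / 4"
proof -
  have "4 * (1 + 2 * t) \<le> 1 + t + t\<^sup>2 / 2"
  proof -
    have "16 * t \<le> t\<^sup>2" unfolding power2_eq_square by (rule mult_right_mono) (use assms in auto)
    moreover have "4 * (1 + 2 * t) \<le> 1 + t + u / 2" if "16 * t \<le> u" for u
      using that assms by simp
    ultimately show ?thesis by blast
  qed
  also have "\<dots> \<le> exp t" using assms by (intro exp_lower_Taylor_quadratic) auto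
  finally have "4 * (1 + 2 * t) * exp (- t) \<le> exp t * exp (- t)"
    by (intro mult_right_mono) auto
  then have "4 * (1 + 2 * t) * exp (- t) \<le> 1" by (simp flip: exp_add)
  then show ?thesis by linarith
qed

text \<open>
  The level \<open>j\<close> is pulled towards \<open>bitlen s\<close>: far above it silence has probability
  at least \<open>3/4\<close>, far below it a collision does, and near it a success is so likely that its
  gain pays for the two units by which \<open>2 * \<bar>j - bitlen s\<bar>\<close> may grow.
\<close>

lemma backoff_drift:
  fixes a b G V p q0 q1 :: real and j s :: nat and d :: "real \<Rightarrow> real"
  defines "p \<equiv> (1 / 2) ^ j" and "d \<equiv> \<lambda>j. 2 * \<bar>j - real (bitlen s)\<bar>"
  defines "q0 \<equiv> (1 - p) ^ s" and "q1 \<equiv> p * (1 - p) ^ (s - 1)"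
  assumes s: "s > 0"
    and a: "j > 0 \<Longrightarrow> a \<le> V + d (real j - 1) - d j"
    and b: "b \<le> V + d (real j + 1) - d j"
    and G: "G \<le> s * (V - backoff_gain)"
  shows "q0 * a + q1 * G + (1 - q0 - q1 * s) * b \<le> V - 1"
proof -
  let ?L = "bitlen s"
  define y where "y = q1 * s"
  define z where "z = 1 - q0 - y"
  have p: "0 < p" "p \<le> 1" by (auto simp: p_def power_le_one)
  have q0: "0 \<le> q0" and q1: "0 \<le> q1" using p by (auto simp: q0_def q1_def)
  have y: "0 \<le> y" using q1 by (simp add: y_def)
  have z: "0 \<le> z"
    using binomial_tail_le_1[of p s] p s by (simp add: z_def y_def q0_def q1_def)
  define t where "t = p * s"
  have load: "t < 2 powr (real ?L - real j)" "2 powr (real ?L - 1 - real j) \<le> t"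
    using backoff_load[OF s, of j] by (auto simp: t_def p_def)
  define da where "da = d (real j - 1) - d j"
  define db where "db = d (real j + 1) - d j"
  have dle: "da \<le> 2" "db \<le> 2" unfolding da_def db_def d_def by (simp_all add: abs_if)
  \<comment> \<open>At level 0 every candidate sends, so \<open>q0 = 0\<close> and both sides
    vanish.\<close>
  have "q0 * a \<le> q0 * (V + da)"
  proof (cases "j = 0")
    case True
    then show ?thesis using s by (simp add: q0_def p_def zero_power)
  next
    case False
    then show ?thesis using a q0 by (intro mult_left_mono) (auto simp: da_def)
  qed
  moreover have "z * b \<le> z * (V + db)"
    using b z by (intro mult_left_mono) (auto simp: db_def)
  moreover have "q1 * G \<le> q1 * (s * (V - backoff_gain))"
    using G q1 by (intro mult_left_mono) auto
  ultimately have *: "q0 * a + q1 * G + z * b \<le> V + q0 * da + z * db - y * backoff_gain"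
    unfolding z_def y_def by (simp add: algebra_simps)
  have yK: "0 \<le> y * backoff_gain" using y backoff_gain_ge by simp
  have sum1: "q0 + y + z = 1" by (simp add: z_def)
  have "q0 * da + z * db - y * backoff_gain \<le> - 1"
  proof -
    \<comment> \<open>At level 0 a single candidate is certain to be heard, and two or more are
      certain to collide. Two or more levels above the target the load is below 1/4, five or more
      below it the load is at least 16; the helpful one of silence and collision then has
      probability at least 3/4, and gaining 2 with weight 3/4 against losing 2 with weight 1/4 gives
      -1. In between, the load lies between 1/4 and 16, and the expected gain of 3 outweighs a
      growth of at most 2.\<close>
    consider "j = 0" "s = 1" | "j = 0" "s \<ge> 2" | "j \<ge> ?L + 2"
      | "j > 0" "j + 5 \<le> ?L" | "j > 0" "j \<le> ?L + 1" "?L \<le> j + 4"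
      using s by linarith
    then show ?thesis
    proof cases
      case 1
      then have "q0 = 0" "y = 1" "z = 0" by (auto simp: q0_def y_def q1_def p_def z_def)
      then show ?thesis using backoff_gain_ge by simp
    next
      case 2
      then have "q0 = 0" "y = 0" by (auto simp: q0_def y_def q1_def p_def zero_power)
      moreover from this have "z = 1" by (simp add: z_def)
      moreover have "?L > 0" using bitlen_pos s by simp
      ultimately show ?thesis using 2 by (simp add: db_def d_def)
    next
      case 3
      have "da = - 2" "db = 2" using 3 by (auto simp: da_def db_def d_def)
      moreover have "1 - t \<le> q0"
        using Bernoulli_inequality[of "- p" s] p by (simp add: q0_def t_def mult.commute)
      moreover have "t \<le> 1 / 4"
      proof -
        have "2 powr (real ?L - real j) \<le> (2 :: real) powr (- 2)"
          using 3 by (intro powr_mono) auto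
        then show ?thesis using load(1) by (simp add: powr_minus)
      qed
      ultimately show ?thesis using sum1 y yK by simp
    next
      case 4
      have dab: "da \<le> 2" "db = - 2" using 4 by (auto simp: da_def db_def d_def)
      have p2: "p \<le> 1 / 2"
        using 4 power_decreasing[of 1 j "1 / 2 :: real"] by (simp add: p_def)
      have "2 powr 4 \<le> (2 :: real) powr (real ?L - 1 - real j)"
        using 4 by (intro powr_mono) auto
      then have t: "t \<ge> 16" using load(2) by simp
      \<comment> \<open>Since \<open>1 - p \<ge> 1 / 2\<close>, dropping one factor at most doubles
        the power, which bounds \<open>y\<close> by a multiple of \<open>q0\<close>.\<close>
      have "(1 - p) ^ (s - 1) \<le> 2 * (1 - p) ^ s"
      proof -
        have "(1 - p) ^ (s - 1) * 1 \<le> (1 - p) ^ (s - 1) * (2 * (1 - p))"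
          using p2 p by (intro mult_left_mono) auto
        then show ?thesis using s by (cases s) (auto simp: algebra_simps)
      qed
      then have "t * (1 - p) ^ (s - 1) \<le> t * (2 * (1 - p) ^ s)"
        using t by (intro mult_left_mono) auto
      then have "y \<le> 2 * t * q0"
        by (simp add: y_def q1_def t_def q0_def mult.assoc mult.left_commute mult.commute)
      then have "q0 + y \<le> (1 + 2 * t) * q0" by (simp add: algebra_simps)
      also have "\<dots> \<le> (1 + 2 * t) * exp (- t)"
        using power_one_minus_le[of p s] p t by (intro mult_left_mono) (auto simp: q0_def t_def)
      also have "\<dots> \<le> 1 / 4" using collision_tail t by simp
      finally have xy: "q0 + y \<le> 1 / 4" .
      moreover have "q0 * da \<le> q0 * 2" using q0 dab by (intro mult_left_mono) auto
      ultimately show ?thesis using sum1 y yK dab by simp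
    next
      case 5
      have p2: "p \<le> 1 / 2"
        using 5 power_decreasing[of 1 j "1 / 2 :: real"] by (simp add: p_def)
      have "2 powr (real ?L - real j) \<le> (2 :: real) powr 4"
        using 5 by (intro powr_mono) auto
      then have t16: "t \<le> 16" using load(1) by simp
      have "(2 :: real) powr (- 2) \<le> 2 powr (real ?L - 1 - real j)"
        using 5 by (intro powr_mono) auto
      then have t4: "1 / 4 \<le> t" using load(2) by (simp add: powr_minus)
      have "exp (- 32) \<le> exp (- 2 * (p * real s))" using t16 by (simp add: t_def)
      also have "\<dots> \<le> (1 - p) ^ s" using p p2 by (intro power_one_minus_ge) auto
      also have "\<dots> \<le> (1 - p) ^ (s - 1)" using p by (intro power_decreasing) auto
      finally have "1 / 4 * exp (- 32) \<le> t * (1 - p) ^ (s - 1)"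
        using t4 by (intro mult_mono) auto
      then have "success_bound \<le> y"
        by (simp add: success_bound_def y_def q1_def t_def mult.commute mult.left_commute)
      then have "success_bound * backoff_gain \<le> y * backoff_gain"
        using backoff_gain_ge by (intro mult_right_mono) auto
      then have "3 \<le> y * backoff_gain" using backoff_gain_success by (simp add: mult.commute)
      moreover have "q0 * da \<le> q0 * 2" "z * db \<le> z * 2"
        using q0 z dle by (auto intro!: mult_left_mono)
      ultimately show ?thesis using sum1 y by linarith
    qed
  qed
  then show ?thesis using * by (simp add: z_def y_def)
qed

section \<open>The algorithm and its invariant\<close>

text \<open>The state that every station computes alike from the channel. In a search
  \<open>bound\<close> is the last, hence least, weight announced in it, or infinity if there is
  none yet; in a collection it is the weight being added.\<close>

record progress =
  clock :: nat
  finished :: bool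
  forest :: "edge set"
  bound :: ereal
  collecting :: bool
  level :: nat

definition start :: progress where
  "start = \<lparr>clock = 0, finished = False, forest = {}, bound = \<infinity>, collecting = False, level = 0\<rparr>"

definition candidate :: "progress \<Rightarrow> edge \<Rightarrow> real \<Rightarrow> bool" where
  "candidate P e w \<longleftrightarrow> e \<notin> spanned (forest P) \<and>
     (if collecting P then ereal w = bound P else ereal w < bound P)"

text \<open>Silence at level 0 in a search with infinite bound means that no unspanned edge exists,
  as each would be a candidate. \<open>the\<close> and \<open>hd\<close> only meet messages that
  carry an edge and its weight, since stations send no others.\<close>

definition backoff_update :: "progress \<Rightarrow> feedback \<Rightarrow> progress" where
  "backoff_update P x = (case x of
     Silence \<Rightarrow>
       if level P > 0 then P\<lparr>level := level P - 1\<rparr>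
       else if collecting P then P\<lparr>collecting := False, bound := \<infinity>\<rparr>
       else if bound P = \<infinity> then P\<lparr>finished := True\<rparr>
       else P\<lparr>collecting := True\<rparr>
   | Heard msg \<Rightarrow>
       if collecting P then P\<lparr>forest := insert (the (message_edge msg)) (forest P)\<rparr>
       else P\<lparr>bound := ereal (hd (message_data msg))\<rparr>
   | Collision \<Rightarrow> P\<lparr>level := Suc (level P)\<rparr>)"

text \<open>Edges heard in round-robin steps are revealed but do not enter the forest, so these
  steps leave the running phase undisturbed.\<close>

definition update :: "progress \<Rightarrow> feedback \<Rightarrow> progress" where
  "update P x = (let Q = P\<lparr>clock := Suc (clock P)\<rparr> in
     if odd (clock P) then backoff_update Q x
     else if x = Silence then Q\<lparr>finished := True\<rparr> else Q)"

definition progress_of :: "feedback list \<Rightarrow> progress" where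
  "progress_of h = foldl update start h"

text \<open>Coins are also flipped, and ignored, in round-robin steps, so that one distribution
  describes every step.\<close>

definition forest_finder :: algorithm where
  "forest_finder =
     \<lparr>coin_count = (\<lambda>v. level (progress_of (channel_heard v))),
      choose_action = (\<lambda>v bs. let P = progress_of (channel_heard v) in
        if (if even (clock P) then my_id v = Suc (clock P div 2)
            else candidate P (my_edge v) (my_weight v) \<and> (\<forall>b\<in>set bs. b))
        then Broadcast True [my_weight v] else Listen),
      halts = (\<lambda>v. finished (progress_of (channel_heard v)))\<rparr>"

definition candidates :: "input \<Rightarrow> progress \<Rightarrow> nat set" where
  "candidates I P = {i\<in>stations I. candidate P (held I i) (weight I (held I i))}"

definition announcement :: "input \<Rightarrow> nat \<Rightarrow> feedback" where
  "announcement I i = Heard (Message (Some (held I i)) [weight I (held I i)])"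

definition outcome :: "input \<Rightarrow> nat set \<Rightarrow> feedback" where
  "outcome I B = (if B = {} then Silence
     else if card B = 1 then announcement I (the_elem B) else Collision)"

text \<open>\<open>R\<close> stands for the revealed edges. Lightness is required of spanned edges
  only and becomes \<open>light\<close> once the forest spans everything.
  \<open>Suc (clock P) div 2\<close> counts the round-robin turns taken; keeping it at most
  \<open>num_edges I\<close> in unfinished states yields the worst-case bound. In a search a finite
  bound is the weight of an unspanned edge, so a collection aims at a weight that occurs.\<close>

definition invariant :: "input \<Rightarrow> progress \<Rightarrow> edge set \<Rightarrow> bool" where
  "invariant I P R \<longleftrightarrow>
     forest P \<subseteq> edges I \<inter> R \<and> indep (forest P) \<and>
     (\<forall>e\<in>edges I \<inter> spanned (forest P).
        e \<in> spanned {f\<in>forest P. weight I f \<le> weight I e}) \<and>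
     (\<forall>i\<in>stations I. i \<le> Suc (clock P) div 2 \<longrightarrow> held I i \<in> R) \<and>
     (if finished P then edges I \<subseteq> R \<or> edges I \<subseteq> spanned (forest P)
      else Suc (clock P) div 2 \<le> num_edges I \<and>
        (if collecting P
         then (\<exists>b. bound P = ereal b) \<and>
           (\<forall>e\<in>edges I - spanned (forest P). bound P \<le> ereal (weight I e)) \<and>
           (\<forall>f\<in>forest P. ereal (weight I f) \<le> bound P)
         else (\<forall>f\<in>forest P. \<forall>e\<in>edges I - spanned (forest P). weight I f < weight I e) \<and>
           (bound P = \<infinity> \<or>
             (\<exists>e\<in>edges I - spanned (forest P). bound P = ereal (weight I e)))))"

definition announced :: "feedback \<Rightarrow> edge set" where
  "announced x = {e. \<exists>xs. x = Heard (Message (Some e) xs)}"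

lemma announced_simps [simp]:
  "announced Silence = {}" "announced Collision = {}" "announced (announcement I i) = {held I i}"
  by (auto simp: announced_def announcement_def)

lemma backoff_update_simps:
  "backoff_update P Silence =
     (if level P > 0 then P\<lparr>level := level P - 1\<rparr>
      else if collecting P then P\<lparr>collecting := False, bound := \<infinity>\<rparr>
      else if bound P = \<infinity> then P\<lparr>finished := True\<rparr>
      else P\<lparr>collecting := True\<rparr>)"
  "backoff_update P (announcement I i) =
     (if collecting P then P\<lparr>forest := insert (held I i) (forest P)\<rparr>
      else P\<lparr>bound := ereal (weight I (held I i))\<rparr>)"
  "backoff_update P Collision = P\<lparr>level := Suc (level P)\<rparr>"
  by (simp_all add: backoff_update_def announcement_def)

lemma finite_stations [simp]: "finite (stations I)"
  by (simp add: stations_def)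

lemma finite_candidates [simp]: "finite (candidates I P)"
  by (simp add: candidates_def)

lemma outcome_cases:
  assumes "finite B"
  obtains "B = {}" "outcome I B = Silence"
    | i where "B = {i}" "outcome I B = announcement I i"
    | "B \<noteq> {}" "outcome I B = Collision"
proof -
  consider "B = {}" | i where "B = {i}" | "B \<noteq> {}" "card B \<noteq> 1"
    by (metis card_1_singletonE)
  then show ?thesis
    using that by cases (auto simp: outcome_def)
qed

lemma held_surj: "valid_input I \<Longrightarrow> e \<in> edges I \<Longrightarrow> \<exists>i\<in>stations I. held I i = e"
  unfolding valid_input_def bij_betw_def by (metis imageE)

lemma held_edge: "valid_input I \<Longrightarrow> i \<in> stations I \<Longrightarrow> held I i \<in> edges I"
  unfolding valid_input_def by (metis bij_betwE)

lemma no_candidates: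
  assumes "valid_input I" "candidates I P = {}" "e \<in> edges I"
  shows "\<not> candidate P e (weight I e)"
  using held_surj[OF assms(1,3)] assms(2) by (auto simp: candidates_def)

lemma invariant_start: "invariant I start {}"
proof -
  have "edges I \<inter> spanned {} \<subseteq> spanned {}" by auto
  then show ?thesis by (simp add: invariant_def start_def indep_def stations_def)
qed

text \<open>A newly spanned edge weighs at least the bound and all edges of the new forest at most
  that, so for such an edge the weight filter removes nothing.\<close>

lemma invariant_insert:
  assumes v: "valid_input I" and inv: "invariant I P R" and n: "\<not> finished P"
    and c: "collecting P" and i: "i \<in> candidates I P" and odd: "odd (clock P)"
  shows "invariant I (P\<lparr>clock := Suc (clock P), forest := insert (held I i) (forest P)\<rparr>)
    (insert (held I i) R)"
proof -
  let ?F = "forest P" and ?e = "held I i"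
  let ?G = "insert ?e ?F"
  have F: "?F \<subseteq> edges I" "?F \<subseteq> R" "indep ?F"
    "\<And>e. e \<in> edges I \<Longrightarrow> e \<in> spanned ?F \<Longrightarrow> e \<in> spanned {f\<in>?F. weight I f \<le> weight I e}"
    using inv by (auto simp: invariant_def)
  obtain b where b: "bound P = ereal b"
    using inv n c by (auto simp: invariant_def)
  have lo: "\<And>e. e \<in> edges I \<Longrightarrow> e \<notin> spanned ?F \<Longrightarrow> b \<le> weight I e"
    and hi: "\<And>f. f \<in> ?F \<Longrightarrow> weight I f \<le> b"
    using inv n c b by (auto simp: invariant_def)
  have e: "?e \<in> edges I" "?e \<notin> spanned ?F" "weight I ?e = b"
    using i c b held_edge[OF v] by (auto simp: candidates_def candidate_def)
  have sub: "spanned ?F \<subseteq> spanned ?G" by (rule spanned_mono) auto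
  have "indep ?G"
    using F e valid_input_card[OF v] by (intro indep_insert) auto
  moreover have "e' \<in> spanned {f\<in>?G. weight I f \<le> weight I e'}"
    if e': "e' \<in> edges I" "e' \<in> spanned ?G" for e'
  proof (cases "e' \<in> spanned ?F")
    case True
    then have "e' \<in> spanned {f\<in>?F. weight I f \<le> weight I e'}" using F e' by blast
    moreover have "{f\<in>?F. weight I f \<le> weight I e'} \<subseteq> {f\<in>?G. weight I f \<le> weight I e'}" by auto
    ultimately show ?thesis using spanned_mono by blast
  next
    case False
    then have "b \<le> weight I e'" using lo e' by blast
    then have "{f\<in>?G. weight I f \<le> weight I e'} = ?G" using hi e by fastforce
    then show ?thesis using e' by simp
  qed
  moreover have "\<forall>e\<in>edges I - spanned ?G. b \<le> weight I e" using lo sub by blast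
  moreover have "\<forall>f\<in>?G. weight I f \<le> b" using hi e by auto
  moreover have "Suc (Suc (clock P)) div 2 = Suc (clock P) div 2"
    using odd by presburger
  ultimately show ?thesis
    using inv n c F e b unfolding invariant_def by auto
qed

text \<open>This covers every set of senders that the coins may produce, so correctness is certain
  and only the time is random. At level 0, where phases end, the set is forced.\<close>

lemma invariant_backoff:
  assumes v: "valid_input I" and inv: "invariant I P R" and n: "\<not> finished P"
    and odd: "odd (clock P)" and B: "B \<subseteq> candidates I P" "level P = 0 \<Longrightarrow> B = candidates I P"
  shows "invariant I (update P (outcome I B)) (R \<union> announced (outcome I B))"
proof -
  have fB: "finite B" using B(1) finite_candidates finite_subset by meson
  have clk: "Suc (Suc (clock P)) div 2 = Suc (clock P) div 2"
    using odd by presburger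
  let ?F = "forest P"
  from fB show ?thesis
  proof (cases rule: outcome_cases[of B I])
    case 1
    have "\<not> candidate P e (weight I e)" if "e \<in> edges I" "level P = 0" for e
      using B(2) 1 that no_candidates[OF v] by simp
    then have nc: "if collecting P then ereal (weight I e) \<noteq> bound P else bound P \<le> ereal (weight I e)"
      if "level P = 0" "e \<in> edges I" "e \<notin> spanned ?F" for e
      using that by (fastforce simp: candidate_def not_less)
    consider "level P > 0" | "level P = 0" "collecting P"
      | "level P = 0" "\<not> collecting P" "bound P = \<infinity>"
      | "level P = 0" "\<not> collecting P" "bound P \<noteq> \<infinity>"
      by blast
    then show ?thesis
    proof cases
      case a: 1
      then show ?thesis
        using inv n clk odd 1 by (simp add: invariant_def update_def backoff_update_simps)
    next
      case a: 2
      then obtain b where b: "bound P = ereal b" using inv n by (auto simp: invariant_def)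
      \<comment> \<open>After a collection the remaining unspanned edges weigh at least
        \<open>b\<close>, and none of them exactly \<open>b\<close>.\<close>
      have "weight I f < weight I e"
        if "f \<in> ?F" "e \<in> edges I - spanned ?F" for e f
      proof -
        have "weight I f \<le> b" "b \<le> weight I e" "weight I e \<noteq> b"
          using inv n a b that nc[of e] by (auto simp: invariant_def)
        then show ?thesis by simp
      qed
      then show ?thesis
        using inv n clk odd 1 a by (simp add: invariant_def update_def backoff_update_simps)
    next
      case a: 3
      then have "edges I \<subseteq> spanned ?F" using nc by fastforce
      then show ?thesis
        using inv n clk odd 1 a by (simp add: invariant_def update_def backoff_update_simps)
    next
      case a: 4
      \<comment> \<open>A finite bound is the weight of an unspanned edge; with no candidate below
        it, it is the least such weight.\<close>
      then obtain e where e: "e \<in> edges I - spanned ?F" "bound P = ereal (weight I e)"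
        using inv n by (auto simp: invariant_def)
      have "\<forall>f\<in>?F. ereal (weight I f) \<le> bound P"
        using inv n a e by (auto simp: invariant_def less_imp_le)
      moreover have "\<forall>e\<in>edges I - spanned ?F. bound P \<le> ereal (weight I e)"
        using nc a by auto
      ultimately show ?thesis
        using inv n clk odd 1 a e by (simp add: invariant_def update_def backoff_update_simps)
    qed
  next
    case (2 i)
    then have i: "i \<in> candidates I P" using B by auto
    show ?thesis
    proof (cases "collecting P")
      case True
      then show ?thesis
        using invariant_insert[OF v inv n True i odd] odd 2
        by (simp add: update_def backoff_update_simps)
    next
      case False
      have "held I i \<in> edges I - spanned ?F"
        using i held_edge[OF v] by (auto simp: candidates_def candidate_def)
      then show ?thesis
        using inv n clk odd 2 False
        by (auto simp: invariant_def update_def backoff_update_simps)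
    qed
  next
    case 3
    then show ?thesis
      using inv n clk odd by (simp add: invariant_def update_def backoff_update_simps)
  qed
qed

text \<open>A silent turn means that the identifier exceeds the number of edges, and all smaller
  ones have had their turn. The second part makes a turn that does not finish the run neutral for
  the potential.\<close>

lemma invariant_round_robin:
  assumes v: "valid_input I" and inv: "invariant I P R" and n: "\<not> finished P"
    and even: "even (clock P)"
  defines "x \<equiv> outcome I {i\<in>stations I. i = Suc (clock P div 2)}"
  shows "invariant I (update P x) (R \<union> announced x)"
    and "\<not> finished (update P x) \<Longrightarrow> update P x = P\<lparr>clock := Suc (clock P)\<rparr>"
proof -
  have clk: "Suc (clock P) div 2 = clock P div 2" "Suc (Suc (clock P)) div 2 = Suc (clock P div 2)"
    using even by presburger+
  have "invariant I (update P x) (R \<union> announced x) \<and>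
      (\<not> finished (update P x) \<longrightarrow> update P x = P\<lparr>clock := Suc (clock P)\<rparr>)"
  proof (cases "Suc (clock P div 2) \<in> stations I")
    case True
    then have "{i\<in>stations I. i = Suc (clock P div 2)} = {Suc (clock P div 2)}" by auto
    then have x: "x = announcement I (Suc (clock P div 2))" by (simp add: x_def outcome_def)
    then have up: "update P x = P\<lparr>clock := Suc (clock P)\<rparr>"
      using even by (simp add: update_def announcement_def)
    have "invariant I (P\<lparr>clock := Suc (clock P)\<rparr>) (insert (held I (Suc (clock P div 2))) R)"
      using inv n True clk by (auto simp: invariant_def le_Suc_eq stations_def)
    then show ?thesis using up x by simp
  next
    case False
    then have "{i\<in>stations I. i = Suc (clock P div 2)} = {}" by auto
    then have x: "x = Silence" by (simp add: x_def outcome_def)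
    then have up: "update P x = P\<lparr>clock := Suc (clock P), finished := True\<rparr>"
      using even by (simp add: update_def)
    have "num_edges I \<le> clock P div 2" using False by (simp add: stations_def)
    then have all: "\<forall>i\<in>stations I. held I i \<in> R"
      using inv clk by (auto simp: invariant_def stations_def)
    then have "edges I \<subseteq> R" using held_surj[OF v] by blast
    then have "invariant I (P\<lparr>clock := Suc (clock P), finished := True\<rparr>) R"
      using inv n all by (auto simp: invariant_def)
    then show ?thesis using up x by simp
  qed
  then show "invariant I (update P x) (R \<union> announced x)"
    and "\<not> finished (update P x) \<Longrightarrow> update P x = P\<lparr>clock := Suc (clock P)\<rparr>"
    by auto
qed

lemma finished_invariant:
  assumes v: "valid_input I" and inv: "invariant I P R" and f: "finished P"
  shows "\<exists>T. min_spanning_forest I T \<and> T \<subseteq> R"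
proof -
  have c: "\<forall>e\<in>edges I. card e = 2" using v by (simp add: valid_input_card)
  consider "edges I \<subseteq> R" | "edges I \<subseteq> spanned (forest P)"
    using inv f by (auto simp: invariant_def)
  then show ?thesis
  proof cases
    case 1
    obtain T where "min_spanning_forest I T" using min_spanning_forest_exists[OF v] by blast
    moreover from this have "T \<subseteq> edges I"
      by (simp add: min_spanning_forest_def spanning_forest_def)
    ultimately show ?thesis using 1 by blast
  next
    case 2
    then have "spanning_forest (edges I) (forest P)" "light I (edges I) (forest P)"
      using inv spanning_forest_iff[OF c] by (auto simp: invariant_def light_def)
    then have "min_spanning_forest I (forest P)" by (rule light_min_spanning_forest[OF v])
    then show ?thesis using inv by (auto simp: invariant_def)
  qed
qed

section \<open>Potential of a state\<close>

text \<open>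
  An announcement lowers the potential by \<open>backoff_gain\<close> on average: through the rank still
  missing while collecting, and through \<open>bitlen\<close> of the number of candidates, which drops
  with probability at least \<open>1/2\<close>, while searching. With \<open>l = bitlen m\<close>, a search starting at
  level 0 costs at most \<open>(2 * backoff_gain + 4) * l\<close> and the level adjustment of a collection at most
  \<open>4 * l\<close>; \<open>phase_cost\<close> is their sum, plus one for each of the two silences that end a phase.
\<close>

definition phase_cost :: "input \<Rightarrow> real" where
  "phase_cost I = (2 * backoff_gain + 8) * bitlen (num_edges I) + 2"

text \<open>The image under \<open>weight I\<close> counts distinct weights, hence phases still to
  come and not edges.\<close>

definition pending :: "input \<Rightarrow> edge set \<Rightarrow> progress \<Rightarrow> real set" where
  "pending I T P = weight I ` (T - spanned (forest P))"

text \<open>A collection takes its own weight out of the pending ones, because that phase has been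
  paid for. A search looks for one of the pending weights, hence the \<open>- 1\<close> and the
  advance of \<open>4 * bitlen (num_edges I) + 2\<close> for the collection to follow; the final
  search has no such weight. In the factor \<open>2 * backoff_gain + 2\<close>, the 2 makes up for
  the moving target.\<close>

definition potential :: "input \<Rightarrow> edge set \<Rightarrow> progress \<Rightarrow> real" where
  "potential I T P =
     (if finished P then 0 else
      backoff_gain * (real (card T) - real (card (forest P))) +
      (let L = real (bitlen (card (candidates I P))) in
       2 * \<bar>real (level P) - L\<bar> +
       (if collecting P
        then 2 * L + phase_cost I * card (pending I T P - {real_of_ereal (bound P)}) + 2
        else (2 * backoff_gain + 2) * L + 1 +
          (if pending I T P = {} then 0
           else phase_cost I * (real (card (pending I T P)) - 1)
             + 4 * bitlen (num_edges I) + 2))))"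

lemma candidates_le: "card (candidates I P) \<le> num_edges I"
proof -
  have "card (candidates I P) \<le> card (stations I)"
    by (intro card_mono) (auto simp: candidates_def)
  then show ?thesis by (simp add: stations_def)
qed

lemma bitlen_candidates_le: "bitlen (card (candidates I P)) \<le> bitlen (num_edges I)"
  by (rule bitlen_mono[OF candidates_le])

lemma candidates_simps [simp]:
  "candidates I (P\<lparr>clock := t\<rparr>) = candidates I P"
  "candidates I (P\<lparr>level := l\<rparr>) = candidates I P"
  "candidates I (P\<lparr>clock := t, level := l\<rparr>) = candidates I P"
  by (simp_all add: candidates_def candidate_def)

lemma potential_clock [simp]: "potential I T (P\<lparr>clock := t\<rparr>) = potential I T P"
  by (simp add: potential_def pending_def Let_def)

text \<open>When the target falls from \<open>l\<close> to \<open>k\<close>, the distance grows by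
  at most \<open>l - k\<close>, which the second summand makes up for.\<close>

lemma level_distance_mono:
  fixes j k l :: real
  assumes "k \<le> l"
  shows "2 * \<bar>j - k\<bar> + 2 * k \<le> 2 * \<bar>j - l\<bar> + 2 * l"
  using assms by (simp add: abs_if)

lemma phase_cost_nonneg: "0 \<le> phase_cost I"
  using backoff_gain_ge by (simp add: phase_cost_def)

context
  fixes I :: input and T :: "edge set"
  assumes v: "valid_input I" and T: "min_spanning_forest I T"
begin

lemma msf_facts: "T \<subseteq> edges I" "finite T" "edges I \<subseteq> spanned T" "light I (edges I) T"
proof -
  have c: "\<forall>e\<in>edges I. card e = 2" using v by (simp add: valid_input_card)
  show "T \<subseteq> edges I" "edges I \<subseteq> spanned T"
    using T spanning_forest_iff[OF c] by (auto simp: min_spanning_forest_def)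
  then show "finite T" using valid_input_finite[OF v] finite_subset by metis
  show "light I (edges I) T" by (rule min_spanning_forest_light[OF v T])
qed

lemma forest_facts:
  assumes "invariant I P R"
  shows "finite (forest P)" "card (forest P) \<le> card T"
proof -
  have F: "forest P \<subseteq> edges I" "indep (forest P)" using assms by (auto simp: invariant_def)
  then show fin: "finite (forest P)" using valid_input_finite[OF v] finite_subset by metis
  show "card (forest P) \<le> card T"
    using F fin msf_facts valid_input_card[OF v] by (intro card_indep_le) auto
qed

lemma finite_pending: "finite (pending I T P)"
  using msf_facts by (simp add: pending_def)

lemma potential_nonneg:
  assumes "invariant I P R"
  shows "0 \<le> potential I T P"
proof -
  have "1 \<le> card (pending I T P)" if "pending I T P \<noteq> {}"
    using that finite_pending by (simp add: Suc_le_eq card_gt_0_iff)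
  then show ?thesis
    using forest_facts[OF assms] backoff_gain_ge phase_cost_nonneg[of I]
    unfolding potential_def Let_def by (auto intro!: add_nonneg_nonneg mult_nonneg_nonneg)
qed

text \<open>
  An unspanned edge of least weight is spanned by edges of \<open>T\<close> that are no heavier,
  and the strictly lighter ones among these are already spanned.
\<close>

lemma lightest_pending:
  assumes e: "e \<in> edges I - spanned F"
    and least: "\<And>e'. e' \<in> edges I - spanned F \<Longrightarrow> weight I e \<le> weight I e'"
  shows "\<exists>t\<in>T - spanned F. weight I t = weight I e"
proof (rule ccontr)
  assume n: "\<not> ?thesis"
  let ?L = "{f\<in>T. weight I f \<le> weight I e}"
  have "?L \<subseteq> spanned F"
  proof
    fix f assume f: "f \<in> ?L"
    show "f \<in> spanned F"
    proof (rule ccontr)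
      assume "f \<notin> spanned F"
      then have "weight I e \<le> weight I f" using least[of f] f msf_facts by auto
      then show False using n f \<open>f \<notin> spanned F\<close> by force
    qed
  qed
  then have "spanned ?L \<subseteq> spanned F" by (rule spanned_trans)
  moreover have "e \<in> spanned ?L" using msf_facts e by (auto simp: light_def)
  ultimately show False using e by blast
qed

lemma pending_nonempty:
  assumes "candidates I P \<noteq> {}"
  shows "pending I T P \<noteq> {}"
proof
  assume "pending I T P = {}"
  then have "T \<subseteq> spanned (forest P)" by (auto simp: pending_def)
  then have "edges I \<subseteq> spanned (forest P)" using msf_facts spanned_trans by blast
  then show False
    using assms held_edge[OF v] by (auto simp: candidates_def candidate_def)
qed

lemma potential_collision:
  assumes "\<not> finished P" "odd (clock P)"
  defines "L \<equiv> real (bitlen (card (candidates I P)))"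
  shows "potential I T (update P Collision) =
    potential I T P + 2 * \<bar>real (level P) + 1 - L\<bar> - 2 * \<bar>real (level P) - L\<bar>"
  using assms
  by (simp add: update_def backoff_update_simps potential_def Let_def pending_def add.commute)

lemma potential_silence:
  assumes "\<not> finished P" "odd (clock P)" "level P > 0"
  defines "L \<equiv> real (bitlen (card (candidates I P)))"
  shows "potential I T (update P Silence) =
    potential I T P + 2 * \<bar>real (level P) - 1 - L\<bar> - 2 * \<bar>real (level P) - L\<bar>"
  using assms
  by (simp add: update_def backoff_update_simps potential_def Let_def pending_def of_nat_diff)

lemma potential_end_of_phase:
  assumes inv: "invariant I P R" and n: "\<not> finished P" "odd (clock P)" "level P = 0"
    and nc: "candidates I P = {}"
  shows "potential I T (update P Silence) \<le> potential I T P - 1"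
proof -
  let ?F = "forest P" and ?U = "pending I T P"
  let ?Q = "update P Silence"
  have ncand: "\<not> candidate P e (weight I e)" if "e \<in> edges I" for e
    using no_candidates[OF v nc that] .
  consider "collecting P" | "\<not> collecting P" "bound P = \<infinity>" | "\<not> collecting P" "bound P \<noteq> \<infinity>"
    by blast
  then show ?thesis
  proof cases
    case 1
    then obtain b where b: "bound P = ereal b" using inv n by (auto simp: invariant_def)
    have up: "?Q = P\<lparr>clock := Suc (clock P), collecting := False, bound := \<infinity>\<rparr>"
      using n 1 by (simp add: update_def backoff_update_simps)
    let ?L = "real (bitlen (card (candidates I ?Q)))"
    \<comment> \<open>Nothing of weight \<open>b\<close> is left unspanned, so all pending weights
      are still to be paid for, and the new search can draw on one
      \<open>phase_cost\<close>.\<close>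
    have "b \<notin> ?U"
      using ncand msf_facts 1 b by (auto simp: pending_def candidate_def)
    then have U: "?U - {real_of_ereal (bound P)} = ?U" using b by simp
    have P: "potential I T P = backoff_gain * (real (card T) - real (card ?F))
        + phase_cost I * card ?U + 2"
      using n 1 nc U by (simp add: potential_def)
    have Q: "potential I T ?Q = backoff_gain * (real (card T) - real (card ?F))
        + (2 * backoff_gain + 4) * ?L + 1 + (if ?U = {} then 0
           else phase_cost I * (real (card ?U) - 1) + 4 * bitlen (num_edges I) + 2)"
      using n 1 by (simp add: potential_def Let_def pending_def up algebra_simps)
    have "?L \<le> bitlen (num_edges I)"
      by (simp add: bitlen_candidates_le)
    then have L: "(2 * backoff_gain + 4) * ?L \<le> (2 * backoff_gain + 4) * bitlen (num_edges I)"
      using backoff_gain_ge by (intro mult_left_mono) auto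
    show ?thesis
    proof (cases "?U = {}")
      case True
      then have "pending I T ?Q = {}" by (simp add: up pending_def)
      then have "candidates I ?Q = {}" using pending_nonempty by blast
      then show ?thesis using P Q True by simp
    next
      case False
      have "(2 * backoff_gain + 4) * bitlen (num_edges I) + 4 * bitlen (num_edges I) + 2
          = phase_cost I"
        by (simp add: phase_cost_def algebra_simps)
      moreover have "phase_cost I * (real (card ?U) - 1) = phase_cost I * card ?U - phase_cost I"
        by (simp add: algebra_simps)
      ultimately show ?thesis using P Q False L by simp
    qed
  next
    case 2
    then have "?Q = P\<lparr>clock := Suc (clock P), finished := True\<rparr>"
      using n by (simp add: update_def backoff_update_simps)
    then have Q: "potential I T ?Q = 0" by (simp add: potential_def)
    have "1 \<le> card ?U" if "?U \<noteq> {}"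
      using that finite_pending by (simp add: Suc_le_eq card_gt_0_iff)
    then have "0 \<le> (if ?U = {} then 0 else phase_cost I * (real (card ?U) - 1)
        + 4 * bitlen (num_edges I) + 2)"
      using phase_cost_nonneg[of I] by simp
    moreover have "0 \<le> backoff_gain * (real (card T) - real (card ?F))"
      using forest_facts[OF inv] backoff_gain_ge by simp
    ultimately have "1 \<le> potential I T P"
      using n 2 nc by (simp add: potential_def)
    then show ?thesis using Q by simp
  next
    case 3
    then obtain e where e: "e \<in> edges I - spanned ?F" "bound P = ereal (weight I e)"
      using inv n by (auto simp: invariant_def)
    \<comment> \<open>Without candidates, \<open>bound P\<close> is the least unspanned weight.
      Hence it is pending, and taking it out accounts for the \<open>- 1\<close> in the potential of
      a search.\<close>
    have "weight I e \<le> weight I e'" if "e' \<in> edges I - spanned ?F" for e'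
      using ncand[of e'] that 3 e by (simp add: candidate_def)
    then obtain t where "t \<in> T - spanned ?F" "weight I t = weight I e"
      using lightest_pending[OF e(1)] by blast
    then have U: "weight I e \<in> ?U" by (metis imageI pending_def)
    have up: "?Q = P\<lparr>clock := Suc (clock P), collecting := True\<rparr>"
      using n 3 by (simp add: update_def backoff_update_simps)
    let ?L = "real (bitlen (card (candidates I ?Q)))"
    have "?L \<le> bitlen (num_edges I)"
      by (simp add: bitlen_candidates_le)
    moreover have "real (card (?U - {weight I e})) = real (card ?U) - 1"
      using U finite_pending card_Suc_Diff1[of ?U "weight I e"] by simp
    moreover have "potential I T ?Q = backoff_gain * (real (card T) - real (card ?F))
        + 4 * ?L + phase_cost I * card (?U - {weight I e}) + 2"
      using n e by (simp add: potential_def Let_def pending_def up)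
    moreover have "potential I T P = backoff_gain * (real (card T) - real (card ?F)) + 1 +
        phase_cost I * (real (card ?U) - 1) + 4 * bitlen (num_edges I) + 2"
      using n 3 nc U by (auto simp: potential_def)
    ultimately show ?thesis by simp
  qed
qed

text \<open>One more forest edge lowers the missing rank by 1, worth \<open>backoff_gain\<close>,
  while candidates and pending weights can only shrink.\<close>

lemma potential_collect:
  assumes inv: "invariant I P R" and n: "\<not> finished P" "odd (clock P)" "collecting P"
    and i: "i \<in> candidates I P"
  shows "potential I T (update P (announcement I i)) \<le> potential I T P - backoff_gain"
proof -
  let ?F = "forest P" and ?e = "held I i"
  let ?Q = "update P (announcement I i)"
  have up: "?Q = P\<lparr>clock := Suc (clock P), forest := insert ?e ?F\<rparr>"
    using n by (simp add: update_def backoff_update_simps)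
  have "?e \<notin> spanned ?F" using i by (simp add: candidates_def candidate_def)
  then have "?e \<notin> ?F"
    using spanned_superset[of ?F] inv valid_input_card[OF v] by (auto simp: invariant_def)
  then have F: "real (card (insert ?e ?F)) = real (card ?F) + 1"
    using forest_facts[OF inv] by simp
  have sub: "spanned ?F \<subseteq> spanned (insert ?e ?F)" by (rule spanned_mono) auto
  then have "candidates I ?Q \<subseteq> candidates I P"
    by (auto simp: candidates_def candidate_def up)
  then have L: "bitlen (card (candidates I ?Q)) \<le> bitlen (card (candidates I P))"
    by (intro bitlen_mono card_mono) auto
  have "pending I T ?Q \<subseteq> pending I T P" using sub by (auto simp: pending_def up)
  then have "card (pending I T ?Q - {real_of_ereal (bound P)})
      \<le> card (pending I T P - {real_of_ereal (bound P)})"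
    using finite_pending by (intro card_mono) auto
  then have "phase_cost I * card (pending I T ?Q - {real_of_ereal (bound P)})
      \<le> phase_cost I * card (pending I T P - {real_of_ereal (bound P)})"
    using phase_cost_nonneg by (intro mult_left_mono) auto
  moreover have "potential I T ?Q = backoff_gain * (real (card T) - (real (card ?F) + 1)) +
      (2 * \<bar>real (level P) - bitlen (card (candidates I ?Q))\<bar> + (2 * bitlen (card (candidates I ?Q))
      + phase_cost I * card (pending I T ?Q - {real_of_ereal (bound P)}) + 2))"
    using n F by (simp add: potential_def Let_def up)
  moreover have "potential I T P = backoff_gain * (real (card T) - real (card ?F)) +
      (2 * \<bar>real (level P) - bitlen (card (candidates I P))\<bar> + (2 * bitlen (card (candidates I P))
      + phase_cost I * card (pending I T P - {real_of_ereal (bound P)}) + 2))"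
    using n by (simp add: potential_def Let_def)
  ultimately show ?thesis
    using level_distance_mono[of "bitlen (card (candidates I ?Q))" "bitlen (card (candidates I P))"
        "level P"] L
    by (simp add: algebra_simps)
qed

text \<open>Only strictly lighter candidates survive. An announcement of low rank at least halves
  their number, which removes a binary digit worth \<open>2 * backoff_gain\<close>.\<close>

lemma potential_search:
  assumes n: "\<not> finished P" "odd (clock P)" "\<not> collecting P"
    and i: "i \<in> candidates I P"
  defines "w \<equiv> \<lambda>i. weight I (held I i)"
  shows "potential I T (update P (announcement I i)) \<le> potential I T P -
    (if 2 * card {k\<in>candidates I P. w k < w i} \<le> card (candidates I P)
     then 2 * backoff_gain else 0)"
proof -
  let ?Q = "update P (announcement I i)" and ?K = "candidates I P"
  have up: "?Q = P\<lparr>clock := Suc (clock P), bound := ereal (w i)\<rparr>"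
    using n by (simp add: update_def backoff_update_simps w_def)
  have "ereal (w i) < bound P"
    using i n by (simp add: candidates_def candidate_def w_def)
  then have below: "ereal (w k) < bound P" if "w k < w i" for k
    using that less_trans[of "ereal (w k)" "ereal (w i)"] by simp
  have K: "candidates I ?Q = {k\<in>?K. w k < w i}"
    using n below by (auto simp: candidates_def candidate_def up w_def)
  define L where "L = real (bitlen (card ?K))"
  define L' where "L' = real (bitlen (card {k\<in>?K. w k < w i}))"
  define X where "X = backoff_gain * (real (card T) - real (card (forest P))) + 1 +
    (if pending I T P = {} then 0
           else phase_cost I * (real (card (pending I T P)) - 1)
             + 4 * bitlen (num_edges I) + 2)"
  have P: "potential I T P = X + 2 * \<bar>real (level P) - L\<bar> + (2 * backoff_gain + 2) * L"
    using n by (simp add: potential_def Let_def X_def L_def)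
  have Q: "potential I T ?Q = X + 2 * \<bar>real (level P) - L'\<bar> + (2 * backoff_gain + 2) * L'"
    using n K unfolding potential_def Let_def L'_def X_def by (simp add: up pending_def)
  have LL: "L' \<le> L"
    unfolding L_def L'_def by (simp add: bitlen_mono card_mono)
  have diff: "potential I T ?Q \<le> potential I T P - 2 * backoff_gain * (L - L')"
  proof -
    have "2 * \<bar>real (level P) - L'\<bar> + 2 * L' \<le> 2 * \<bar>real (level P) - L\<bar> + 2 * L"
      using LL by (rule level_distance_mono)
    then show ?thesis using P Q by (simp add: algebra_simps)
  qed
  show ?thesis
  proof (cases "2 * card {k\<in>?K. w k < w i} \<le> card ?K")
    case True
    have "card ?K > 0" using i by (auto simp: card_gt_0_iff)
    then have "L' + 1 \<le> L"
      using bitlen_half[OF _ True] unfolding L_def L'_def by linarith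
    then have "2 * backoff_gain * 1 \<le> 2 * backoff_gain * (L - L')"
      using backoff_gain_ge by (intro mult_left_mono) auto
    then show ?thesis using True diff by simp
  next
    case False
    have "0 \<le> 2 * backoff_gain * (L - L')"
      using LL backoff_gain_ge by simp
    then show ?thesis using False diff by simp
  qed
qed

text \<open>A plain sum suffices because a lone sender is equally likely to be any candidate. In a
  search at least half of them gain \<open>2 * backoff_gain\<close>, hence
  \<open>backoff_gain\<close> on average.\<close>

lemma potential_announcements:
  assumes inv: "invariant I P R" and n: "\<not> finished P" "odd (clock P)"
  defines "K \<equiv> candidates I P"
  shows "(\<Sum>i\<in>K. potential I T (update P (announcement I i))) \<le>
    card K * (potential I T P - backoff_gain)"
proof (cases "collecting P")
  case True
  then show ?thesis
    unfolding K_def by (intro sum_bounded_above potential_collect[OF inv n])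
next
  case False
  define w where "w = (\<lambda>i. weight I (held I i))"
  let ?G = "{i\<in>K. 2 * card {k\<in>K. w k < w i} \<le> card K}"
  have fK: "finite K" by (simp add: K_def)
  have "(\<Sum>i\<in>K. potential I T (update P (announcement I i))) \<le>
      (\<Sum>i\<in>K. potential I T P - (if i \<in> ?G then 2 * backoff_gain else 0))"
    using potential_search[OF n False] unfolding K_def w_def by (intro sum_mono) auto
  also have "\<dots> = card K * potential I T P - backoff_gain * (2 * card ?G)"
    using fK by (simp add: sum_subtractf sum.If_cases Int_def)
  also have "\<dots> \<le> card K * potential I T P - backoff_gain * card K"
    using many_small_ranks[OF fK, of w] backoff_gain_ge by (intro diff_left_mono mult_left_mono) auto
  finally show ?thesis by (simp add: algebra_simps)
qed

lemma potential_drift: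
  assumes inv: "invariant I P R" and n: "\<not> finished P" "odd (clock P)"
  shows "measure_pmf.expectation (flip_all (stations I) (level P))
    (\<lambda>r. potential I T (update P (outcome I (senders (candidates I P) r))))
    \<le> potential I T P - 1"
proof -
  let ?K = "candidates I P" and ?pot = "\<lambda>x. potential I T (update P x)"
  have K: "?K \<subseteq> stations I" by (auto simp: candidates_def)
  let ?p = "(1 / 2 :: real) ^ level P"
  let ?q0 = "(1 - ?p) ^ card ?K" and ?q1 = "?p * (1 - ?p) ^ (card ?K - 1)"
  have "measure_pmf.expectation (flip_all (stations I) (level P))
      (\<lambda>r. ?pot (outcome I (senders ?K r))) =
    measure_pmf.expectation (flip_all (stations I) (level P))
      (\<lambda>r. if senders ?K r = {} then ?pot Silence else if card (senders ?K r) = 1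
        then (\<lambda>i. ?pot (announcement I i)) (the_elem (senders ?K r)) else ?pot Collision)"
    by (intro Bochner_Integration.integral_cong) (auto simp: outcome_def)
  also have "\<dots> = ?q0 * ?pot Silence + ?q1 * (\<Sum>i\<in>?K. ?pot (announcement I i))
      + (1 - ?q0 - ?q1 * card ?K) * ?pot Collision"
    by (rule expectation_senders[OF finite_stations K])
  also have "\<dots> \<le> potential I T P - 1"
  proof (cases "?K = {}")
    case True
    have "?pot Silence \<le> potential I T P - 1"
    proof (cases "level P = 0")
      case True
      then show ?thesis using potential_end_of_phase[OF inv n] \<open>?K = {}\<close> by simp
    next
      case False
      \<comment> \<open>Without candidates the target is \<open>bitlen 0 = 0\<close>, and the
        silence, which is certain, moves the level one step nearer.\<close>
      then show ?thesis using potential_silence[OF n] True by simp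
    qed
    then show ?thesis using True by simp
  next
    case False
    then have "card ?K > 0" by (simp add: card_gt_0_iff)
    then show ?thesis
    proof (rule backoff_drift)
      show "level P > 0 \<Longrightarrow> ?pot Silence \<le> potential I T P
          + 2 * \<bar>real (level P) - 1 - real (bitlen (card ?K))\<bar>
          - 2 * \<bar>real (level P) - real (bitlen (card ?K))\<bar>"
        using potential_silence[OF n] by simp
      show "?pot Collision \<le> potential I T P
          + 2 * \<bar>real (level P) + 1 - real (bitlen (card ?K))\<bar>
          - 2 * \<bar>real (level P) - real (bitlen (card ?K))\<bar>"
        using potential_collision[OF n] by simp
      show "(\<Sum>i\<in>?K. ?pot (announcement I i)) \<le> card ?K * (potential I T P - backoff_gain)"
        by (rule potential_announcements[OF inv n])
    qed
  qed
  finally show ?thesis .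
qed

lemma card_weights_pos:
  assumes "num_edges I > 0"
  shows "0 < card (weight I ` T)" "pending I T start = weight I ` T"
proof -
  have no: "e \<notin> spanned {}" if e: "e \<in> edges I" for e
  proof -
    obtain a b where "e = {a, b}" "a \<noteq> b"
      using valid_input_card[OF v e] by (meson card_2_iff)
    then show ?thesis by (simp add: spanned_pair adj_def)
  qed
  have "edges I \<noteq> {}" using assms by (auto simp: num_edges_def)
  then have "T \<noteq> {}" using no msf_facts by blast
  then show "0 < card (weight I ` T)" using msf_facts by (simp add: card_gt_0_iff)
  have "T - spanned {} = T" using no msf_facts by blast
  then show "pending I T start = weight I ` T" by (simp add: pending_def start_def)
qed

lemma potential_start:
  assumes m: "num_edges I > 0"
  shows "potential I T start \<le>
    (3 * backoff_gain + 11) * (real (card T) + card (weight I ` T) * log 2 (num_edges I))"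
proof -
  let ?\<Lambda> = "real (bitlen (num_edges I))" and ?W = "real (card (weight I ` T))"
  let ?K = "backoff_gain" and ?L = "real (bitlen (card (candidates I start)))"
  let ?l = "log 2 (num_edges I)"
  have "pending I T start \<noteq> {}" using card_weights_pos[OF m] by auto
  then have "potential I T start = ?K * card T + (2 * ?K + 4) * ?L + 1
      + (phase_cost I * (?W - 1) + 4 * ?\<Lambda> + 2)"
    using card_weights_pos(2)[OF m]
    by (simp add: potential_def start_def Let_def algebra_simps)
  also have "(2 * ?K + 4) * ?L \<le> (2 * ?K + 4) * ?\<Lambda>"
    using bitlen_candidates_le backoff_gain_ge by (intro mult_left_mono) auto
  finally have "potential I T start \<le> ?K * card T + 1 + ?W * phase_cost I"
    by (simp add: phase_cost_def algebra_simps)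
  also have "?W * phase_cost I \<le> ?W * ((2 * ?K + 8) * (?l + 1) + 2)"
    unfolding phase_cost_def using bitlen_le_log[OF m] backoff_gain_ge
    by (intro mult_left_mono add_right_mono) auto
  also have "\<dots> = (2 * ?K + 10) * ?W + (2 * ?K + 8) * (?W * ?l)"
    by (simp add: algebra_simps)
  \<comment> \<open>The constant cost of each phase is charged to \<open>card T\<close>, which is at
    least \<open>?W\<close>, as the logarithm vanishes for a single edge.\<close>
  also have "\<dots> \<le> (2 * ?K + 10) * card T + (3 * ?K + 11) * (?W * ?l)"
  proof (rule add_mono)
    have "?W \<le> card T" using msf_facts card_image_le[of T "weight I"] by simp
    then show "(2 * ?K + 10) * ?W \<le> (2 * ?K + 10) * card T"
      using backoff_gain_ge by (intro mult_left_mono) auto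
    have "0 \<le> ?W * ?l" using m by (intro mult_nonneg_nonneg) auto
    then show "(2 * ?K + 8) * (?W * ?l) \<le> (3 * ?K + 11) * (?W * ?l)"
      using backoff_gain_ge by (intro mult_right_mono) auto
  qed
  finally have "potential I T start \<le>
      ?K * card T + 1 + ((2 * ?K + 10) * card T + (3 * ?K + 11) * (?W * ?l))" by simp
  moreover have "1 \<le> real (card T)"
    using card_weights_pos(1)[OF m] card_image_le[of T "weight I"] msf_facts by linarith
  ultimately show ?thesis by (simp add: algebra_simps)
qed

end

section \<open>Runs of the algorithm\<close>

lemma progress_of_snoc: "progress_of (h @ [x]) = update (progress_of h) x"
  by (simp add: progress_of_def)

abbreviation progress_in :: "config \<Rightarrow> progress" where
  "progress_in c \<equiv> progress_of (channel c)"

text \<open>Halting depends on the channel alone, so the stations halt together. Past coins do not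
  occur, because the state is a function of the channel.\<close>

definition reachable_config :: "input \<Rightarrow> config \<Rightarrow> bool" where
  "reachable_config I c \<longleftrightarrow>
     length (channel c) = clock (progress_in c) \<and>
     halted c = (if finished (progress_in c) then stations I else {}) \<and>
     invariant I (progress_in c) (revealed c)"

definition broadcasters :: "input \<Rightarrow> progress \<Rightarrow> (nat \<Rightarrow> bool list) \<Rightarrow> nat set" where
  "broadcasters I P r = (if even (clock P) then {i\<in>stations I. i = Suc (clock P div 2)}
     else senders (candidates I P) r)"

lemma clock_update: "clock (update P x) = Suc (clock P)"
  by (simp add: update_def backoff_update_def Let_def split: feedback.split)

text \<open>With no edges there are no stations, and termination holds vacuously from the
  start.\<close>

lemma terminated_iff:
  assumes "reachable_config I c"
  shows "terminated I c \<longleftrightarrow> num_edges I = 0 \<or> finished (progress_in c)"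
  using assms by (auto simp: reachable_config_def terminated_def stations_def)

lemma initial_reachable: "reachable_config I (initial forest_finder I)"
  using invariant_start
  by (simp add: reachable_config_def initial_def forest_finder_def view_of_def progress_of_def
      revealed_def) (simp add: start_def)

lemma forest_finder_view_of:
  "halts forest_finder (view_of I f h i) = finished (progress_of h)"
  "coin_count forest_finder (view_of I f h i) = level (progress_of h)"
  by (simp_all add: forest_finder_def view_of_def)

lemma channel_feedback_forest_finder:
  "channel_feedback I (stations I)
      (\<lambda>i. choose_action forest_finder (view_of I f h i) (r i)) =
    outcome I (broadcasters I (progress_of h) r)"
proof -
  define a where "a = (\<lambda>i. choose_action forest_finder (view_of I f h i) (r i))"
  let ?B = "broadcasters I (progress_of h) r"
  have B: "{i\<in>stations I. is_Broadcast (a i)} = ?B"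
    by (auto simp: a_def forest_finder_def view_of_def broadcasters_def candidates_def
        senders_def Let_def)
  have act: "a i = Broadcast True [weight I (held I i)]" if "i \<in> ?B" for i
    using that by (auto simp: a_def forest_finder_def view_of_def broadcasters_def
        candidates_def senders_def Let_def)
  have "Heard (message_of I (the_elem ?B) (a (the_elem ?B))) = announcement I (the_elem ?B)"
    if one: "card ?B = 1"
  proof -
    obtain i where "?B = {i}" using one by (rule card_1_singletonE)
    then have "the_elem ?B \<in> ?B" by simp
    then show ?thesis using act by (simp add: announcement_def)
  qed
  then have "channel_feedback I (stations I) a = outcome I ?B"
    by (simp add: channel_feedback_def B Let_def outcome_def)
  then show ?thesis by (simp add: a_def)
qed

lemma revealed_snoc:
  assumes "channel c' = channel c @ [x]"
  shows "revealed c' = revealed c \<union> announced x"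
  using assms by (auto simp: revealed_def announced_def)

lemma next_config_forest_finder:
  fixes I :: input and c c' :: config and r :: "nat \<Rightarrow> bool list" and x :: feedback
  assumes "reachable_config I c" "\<not> finished (progress_in c)"
  defines "c' \<equiv> next_config forest_finder I c r"
    and "x \<equiv> outcome I (broadcasters I (progress_in c) r)"
  shows "channel c' = channel c @ [x]"
    and "progress_in c' = update (progress_in c) x"
    and "halted c' = (if finished (update (progress_in c) x) then stations I else {})"
proof -
  have act: "active I c = stations I" and halt: "halted c = {}"
    using assms by (auto simp: reachable_config_def active_def)
  show ch: "channel c' = channel c @ [x]"
    by (simp add: c'_def next_config_def Let_def act channel_feedback_forest_finder x_def)
  then show "progress_in c' = update (progress_in c) x"
    by (simp add: progress_of_snoc)
  show "halted c' = (if finished (update (progress_in c) x) then stations I else {})"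
    by (simp add: c'_def next_config_def Let_def act halt channel_feedback_forest_finder
        forest_finder_view_of progress_of_snoc x_def)
qed

lemma step_forest_finder:
  assumes "reachable_config I c" "\<not> terminated I c"
  shows "step forest_finder I c = map_pmf (next_config forest_finder I c)
    (flip_all (stations I) (level (progress_in c)))"
proof -
  have act: "active I c = stations I"
    using assms terminated_iff by (auto simp: reachable_config_def active_def)
  show ?thesis
    using assms(2) unfolding step_def act flip_all_def
    by (simp add: forest_finder_view_of)
qed

lemma no_flips_at_level_0:
  assumes "r \<in> set_pmf (flip_all S 0)" "finite S" "K \<subseteq> S"
  shows "senders K r = K"
proof -
  have "r i = []" if "i \<in> S" for i
    using assms that by (auto simp: flip_all_def set_Pi_pmf set_pmf_fair_coins PiE_dflt_def)
  then show ?thesis using assms(3) by (auto simp: senders_def)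
qed

lemma invariant_update:
  assumes v: "valid_input I" and inv: "invariant I P R" and n: "\<not> finished P"
    and r: "r \<in> set_pmf (flip_all (stations I) (level P))"
  defines "x \<equiv> outcome I (broadcasters I P r)"
  shows "invariant I (update P x) (R \<union> announced x)"
proof (cases "even (clock P)")
  case True
  then show ?thesis
    using invariant_round_robin(1)[OF v inv n True] by (simp add: x_def broadcasters_def)
next
  case False
  have "senders (candidates I P) r \<subseteq> candidates I P" by (auto simp: senders_def)
  moreover have "candidates I P \<subseteq> stations I" by (auto simp: candidates_def)
  then have "senders (candidates I P) r = candidates I P" if "level P = 0"
    using no_flips_at_level_0[of r "stations I"] r that by simp
  ultimately show ?thesis
    using invariant_backoff[OF v inv n False] False by (simp add: x_def broadcasters_def)
qed

lemma reachable_next_config: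
  assumes v: "valid_input I" and c: "reachable_config I c" "\<not> finished (progress_in c)"
    and r: "r \<in> set_pmf (flip_all (stations I) (level (progress_in c)))"
  shows "reachable_config I (next_config forest_finder I c r)"
proof -
  note next_facts = next_config_forest_finder[OF c, of r]
  have "invariant I (progress_in c) (revealed c)" using c by (simp add: reachable_config_def)
  then show ?thesis
    using invariant_update[OF v _ c(2) r, of "revealed c"] c(1) next_facts revealed_snoc[OF next_facts(1)]
    by (simp add: reachable_config_def clock_update)
qed

lemma run_reachable:
  assumes v: "valid_input I" and c: "c \<in> set_pmf (run forest_finder I t)"
  shows "reachable_config I c \<and> (terminated I c \<or> length (channel c) = t)"
  using c
proof (induction t arbitrary: c)
  case 0
  then show ?case using initial_reachable[of I] by (simp add: initial_def)
next
  case (Suc t)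
  then obtain b where b: "b \<in> set_pmf (run forest_finder I t)" "c \<in> set_pmf (step forest_finder I b)"
    by auto
  then have IH: "reachable_config I b" "terminated I b \<or> length (channel b) = t"
    using Suc.IH by auto
  show ?case
  proof (cases "terminated I b")
    case True
    then show ?thesis using b IH by (simp add: step_def)
  next
    case False
    then have nf: "\<not> finished (progress_in b)" using terminated_iff[OF IH(1)] by simp
    obtain r where r: "r \<in> set_pmf (flip_all (stations I) (level (progress_in b)))"
      "c = next_config forest_finder I b r"
      using b(2) unfolding step_forest_finder[OF IH(1) False] by auto
    then show ?thesis
      using reachable_next_config[OF v IH(1) nf] next_config_forest_finder(1)[OF IH(1) nf, of r]
        IH(2) False by simp
  qed
qed

section \<open>Correctness and time bounds\<close>

lemma forest_finder_correct:
  assumes v: "valid_input I"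
  shows "finds_min_spanning_forest forest_finder I"
  unfolding finds_min_spanning_forest_def
proof (intro allI ballI impI)
  fix t c assume c: "c \<in> set_pmf (run forest_finder I t)" and t: "terminated I c"
  have r: "reachable_config I c" using run_reachable[OF v c] by simp
  show "\<exists>T. min_spanning_forest I T \<and> T \<subseteq> revealed c"
  proof (cases "num_edges I = 0")
    case True
    then have "edges I = {}" using valid_input_finite[OF v] by (simp add: num_edges_def)
    moreover obtain T where "min_spanning_forest I T" using min_spanning_forest_exists[OF v] by blast
    moreover from this have "T \<subseteq> edges I"
      by (simp add: min_spanning_forest_def spanning_forest_def)
    ultimately show ?thesis by auto
  next
    case False
    then have "finished (progress_in c)" using t terminated_iff[OF r] by simp
    moreover have "invariant I (progress_in c) (revealed c)"
      using r by (simp add: reachable_config_def)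
    ultimately show ?thesis using finished_invariant[OF v] by simp
  qed
qed

text \<open>By then the round robin would have had at least twice as many turns as there are
  stations, but an unfinished run has had at most one turn per station. Leaving \<open>C\<close>
  open lets both time bounds share one constant.\<close>

lemma forest_finder_worst_case:
  assumes v: "valid_input I" and C: "C \<ge> 4"
  shows "terminates_within forest_finder I (C * num_edges I)"
  unfolding terminates_within_def
proof (rule ballI, rule ccontr)
  fix c assume c: "c \<in> set_pmf (run forest_finder I (C * num_edges I))" and n: "\<not> terminated I c"
  have r: "reachable_config I c" "length (channel c) = C * num_edges I"
    using run_reachable[OF v c] n by auto
  then have m: "num_edges I > 0" and "\<not> finished (progress_in c)"
    using n terminated_iff[of I c] by auto
  then have "Suc (clock (progress_in c)) div 2 \<le> num_edges I"
    using r by (simp add: reachable_config_def invariant_def)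
  then have "Suc (C * num_edges I) div 2 \<le> num_edges I"
    using r by (simp add: reachable_config_def)
  moreover have "4 * num_edges I \<le> C * num_edges I" using C by simp
  ultimately show False using m by linarith
qed

text \<open>Only every second step drifts, hence the factor 2; the extra 1 before a round-robin step
  spreads the two units evenly over both steps.\<close>

definition config_potential :: "input \<Rightarrow> edge set \<Rightarrow> config \<Rightarrow> real" where
  "config_potential I T c = (if terminated I c then 0
     else 2 * potential I T (progress_in c) + (if even (clock (progress_in c)) then 1 else 0))"

lemma config_potential_nonneg:
  assumes "valid_input I" "min_spanning_forest I T" "reachable_config I c"
  shows "0 \<le> config_potential I T c"
  using potential_nonneg[OF assms(1,2)] assms(3)
  by (auto simp: config_potential_def reachable_config_def)

lemma config_potential_drift:
  assumes v: "valid_input I" and T: "min_spanning_forest I T" and c: "reachable_config I c"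
    and n: "\<not> terminated I c"
  shows "measure_pmf.expectation (flip_all (stations I) (level (progress_in c)))
      (\<lambda>r. config_potential I T (next_config forest_finder I c r)) \<le> config_potential I T c - 1"
    (is "measure_pmf.expectation ?M ?f \<le> _")
proof -
  let ?P = "progress_in c"
  let ?x = "\<lambda>r. outcome I (broadcasters I ?P r)"
  have nf: "\<not> finished ?P" using n terminated_iff[OF c] by simp
  have inv: "invariant I ?P (revealed c)" using c by (simp add: reachable_config_def)
  have int: "integrable (measure_pmf ?M) f" for f :: "_ \<Rightarrow> real"
    by (intro integrable_measure_pmf_finite finite_set_flip_all finite_stations)
  have pos: "0 \<le> potential I T (update ?P (?x r))" if "r \<in> set_pmf ?M" for r
    using invariant_update[OF v inv nf that] by (rule potential_nonneg[OF v T])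
  have le: "?f r \<le> 2 * potential I T (update ?P (?x r)) + (if even (clock ?P) then 0 else 1)"
    if "r \<in> set_pmf ?M" for r
    using pos[OF that] next_config_forest_finder(2)[OF c nf, of r]
    by (simp add: config_potential_def clock_update)
  show ?thesis
  proof (cases "even (clock ?P)")
    case True
    have "?f r \<le> 2 * potential I T ?P" if r: "r \<in> set_pmf ?M" for r
    proof (cases "finished (update ?P (?x r))")
      case True
      then have "?f r = 0"
        using terminated_iff[OF reachable_next_config[OF v c nf r]]
          next_config_forest_finder(2)[OF c nf, of r]
        by (simp add: config_potential_def)
      then show ?thesis using potential_nonneg[OF v T inv] by simp
    next
      case False
      then have "update ?P (?x r) = ?P\<lparr>clock := Suc (clock ?P)\<rparr>"
        using invariant_round_robin(2)[OF v inv nf True] True by (simp add: broadcasters_def)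
      then show ?thesis using le[OF r] True by simp
    qed
    then have "measure_pmf.expectation ?M ?f \<le> measure_pmf.expectation ?M (\<lambda>_. 2 * potential I T ?P)"
      by (intro integral_mono_AE int AE_pmfI) auto
    then show ?thesis using n True by (simp add: config_potential_def)
  next
    case False
    have "measure_pmf.expectation ?M ?f \<le>
        measure_pmf.expectation ?M (\<lambda>r. 2 * potential I T (update ?P (?x r)) + 1)"
      using le False by (intro integral_mono_AE int AE_pmfI) auto
    also have "\<dots> = 2 * measure_pmf.expectation ?M (\<lambda>r. potential I T (update ?P (?x r))) + 1"
      by (subst Bochner_Integration.integral_add[OF int int]) simp
    also have "\<dots> \<le> 2 * (potential I T ?P - 1) + 1"
      using potential_drift[OF v T inv nf] False by (simp add: broadcasters_def)
    finally show ?thesis using n False by (simp add: config_potential_def)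
  qed
qed

lemma step_drift:
  assumes v: "valid_input I" and T: "min_spanning_forest I T" and c: "reachable_config I c"
  defines "\<Phi> \<equiv> \<lambda>c. ennreal (real (length (channel c)) + config_potential I T c)"
  shows "(\<integral>\<^sup>+ c'. \<Phi> c' \<partial>measure_pmf (step forest_finder I c)) \<le> \<Phi> c"
proof (cases "terminated I c")
  case True
  then show ?thesis by (simp add: step_def)
next
  case False
  let ?M = "flip_all (stations I) (level (progress_in c))"
  let ?f = "\<lambda>r. config_potential I T (next_config forest_finder I c r)"
  have nf: "\<not> finished (progress_in c)" using False terminated_iff[OF c] by simp
  have len: "length (channel (next_config forest_finder I c r)) = Suc (length (channel c))" for r
    using next_config_forest_finder(1)[OF c nf, of r] by simp
  have int: "integrable (measure_pmf ?M) f" for f :: "_ \<Rightarrow> real"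
    by (intro integrable_measure_pmf_finite finite_set_flip_all finite_stations)
  have "(\<integral>\<^sup>+ c'. \<Phi> c' \<partial>measure_pmf (step forest_finder I c)) =
      (\<integral>\<^sup>+ r. ennreal (real (length (channel c)) + 1 + ?f r) \<partial>measure_pmf ?M)"
    unfolding step_forest_finder[OF c False] \<Phi>_def by (simp add: len add.commute)
  also have "\<dots> = ennreal (measure_pmf.expectation ?M (\<lambda>r. real (length (channel c)) + 1 + ?f r))"
    using config_potential_nonneg[OF v T reachable_next_config[OF v c nf]]
    by (intro nn_integral_eq_integral int AE_pmfI) auto
  also have "measure_pmf.expectation ?M (\<lambda>r. real (length (channel c)) + 1 + ?f r) =
      real (length (channel c)) + 1 + measure_pmf.expectation ?M ?f"
    by (subst Bochner_Integration.integral_add[OF int int]) simp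
  also have "ennreal \<dots> \<le> \<Phi> c"
    unfolding \<Phi>_def using config_potential_drift[OF v T c False] by (intro ennreal_leI) simp
  finally show ?thesis .
qed

lemma expected_time_le:
  assumes v: "valid_input I" and T: "min_spanning_forest I T"
  shows "expected_time forest_finder I \<le> ennreal (config_potential I T (initial forest_finder I))"
proof -
  define \<Phi> where "\<Phi> c = ennreal (real (length (channel c)) + config_potential I T c)" for c
  have drift: "(\<integral>\<^sup>+ c. \<Phi> c \<partial>measure_pmf (run forest_finder I t)) \<le> \<Phi> (initial forest_finder I)" for t
  proof (induction t)
    case (Suc t)
    have "(\<integral>\<^sup>+ c. \<Phi> c \<partial>measure_pmf (run forest_finder I (Suc t))) =
        (\<integral>\<^sup>+ b. \<integral>\<^sup>+ c. \<Phi> c \<partial>measure_pmf (step forest_finder I b) \<partial>measure_pmf (run forest_finder I t))"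
      by simp
    also have "\<dots> \<le> (\<integral>\<^sup>+ b. \<Phi> b \<partial>measure_pmf (run forest_finder I t))"
      using step_drift[OF v T] run_reachable[OF v] unfolding \<Phi>_def
      by (intro nn_integral_mono_AE AE_pmfI) auto
    finally show ?case using Suc.IH by (rule order_trans)
  qed simp
  show ?thesis
    unfolding expected_time_def
  proof (rule SUP_least)
    fix t
    have "(\<integral>\<^sup>+ c. of_nat (length (channel c)) \<partial>measure_pmf (run forest_finder I t)) \<le>
        (\<integral>\<^sup>+ c. \<Phi> c \<partial>measure_pmf (run forest_finder I t))"
    proof (intro nn_integral_mono_AE AE_pmfI)
      fix c assume "c \<in> set_pmf (run forest_finder I t)"
      then have "0 \<le> config_potential I T c"
        using run_reachable[OF v] config_potential_nonneg[OF v T] by blast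
      then show "of_nat (length (channel c)) \<le> \<Phi> c"
        unfolding \<Phi>_def ennreal_of_nat_eq_real_of_nat by (intro ennreal_leI) simp
    qed
    also have "\<dots> \<le> \<Phi> (initial forest_finder I)" by (rule drift)
    also have "\<dots> = ennreal (config_potential I T (initial forest_finder I))"
      by (simp add: \<Phi>_def initial_def)
    finally show "(\<integral>\<^sup>+ c. of_nat (length (channel c)) \<partial>measure_pmf (run forest_finder I t)) \<le>
      ennreal (config_potential I T (initial forest_finder I))" .
  qed
qed

lemma initial_potential_le:
  assumes v: "valid_input I" and T: "min_spanning_forest I T"
  shows "config_potential I T (initial forest_finder I) \<le> (6 * backoff_gain + 23) *
    (real (card T) + card (weight I ` T) * log 2 (num_edges I))"
    (is "_ \<le> _ * ?X")
proof (cases "num_edges I = 0")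
  case True
  then show ?thesis
    using terminated_iff[OF initial_reachable, of I] backoff_gain_ge
    by (simp add: config_potential_def log_def)
next
  case False
  have "0 \<le> card (weight I ` T) * log 2 (num_edges I)"
    using False by (intro mult_nonneg_nonneg) auto
  moreover have "1 \<le> real (card T)"
    using card_weights_pos(1)[OF v T] False card_image_le[OF msf_facts(2)[OF v T], of "weight I"]
    by linarith
  ultimately have "1 \<le> ?X" by linarith
  moreover have "config_potential I T (initial forest_finder I) \<le> 2 * potential I T start + 1"
    using potential_nonneg[OF v T invariant_start]
    by (simp add: config_potential_def initial_def progress_of_def)
  moreover have "potential I T start \<le> (3 * backoff_gain + 11) * ?X"
    by (rule potential_start[OF v T]) (use False in simp)
  \<comment> \<open>The potential is doubled, and the 1 for the even initial clock is absorbed by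
    \<open>?X \<ge> 1\<close>, so 23 is 2 * 11 + 1.\<close>
  moreover have "(6 * backoff_gain + 23) * ?X = 2 * ((3 * backoff_gain + 11) * ?X) + ?X"
    by (simp add: algebra_simps)
  ultimately show ?thesis by linarith
qed

theorem theorem4:
  shows "\<exists>(A :: algorithm) (C :: nat). \<forall>I :: input. valid_input I \<longrightarrow>
    finds_min_spanning_forest A I \<and>
    (\<forall>T. min_spanning_forest I T \<longrightarrow>
       expected_time A I \<le>
         ennreal (real C * (real (card T) + real (card (weight I ` T)) * log 2 (real (num_edges I))))) \<and>
    terminates_within A I (C * num_edges I)"
proof -
  define C where "C = nat \<lceil>6 * backoff_gain + 23\<rceil>"
  have C: "6 * backoff_gain + 23 \<le> real C" unfolding C_def by (rule real_nat_ceiling_ge)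
  then have C4: "C \<ge> 4" using backoff_gain_ge by linarith
  show ?thesis
  proof (intro exI[of _ forest_finder] exI[of _ C] allI impI conjI)
    fix I T assume v: "valid_input I" and T: "min_spanning_forest I T"
    let ?X = "real (card T) + real (card (weight I ` T)) * log 2 (real (num_edges I))"
    have "0 \<le> ?X"
      by (cases "num_edges I = 0") (auto intro!: add_nonneg_nonneg mult_nonneg_nonneg simp: log_def)
    then have "config_potential I T (initial forest_finder I) \<le> real C * ?X"
      using initial_potential_le[OF v T] mult_right_mono[OF C] by fastforce
    then show "expected_time forest_finder I \<le> ennreal (real C * ?X)"
      using expected_time_le[OF v T] by (meson ennreal_leI order_trans)
  qed (auto intro: forest_finder_correct forest_finder_worst_case C4)
qed

end
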